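(* Let $\Omega$ be a class of unital $C^*$-algebras, and let $A$ be a simple unital $C^*$-algebra. Then $A\in \mathrm{gTA}\Omega$ if, and only if, $A\in \mathrm{WTA}\Omega$.
   Context: Notation. For an element $x$ and a subset $B$ of a $C^*$-algebra $A$, $x\in_{\varepsilon} B$ means that there is $b\in B$ with $\|x-b\|<\varepsilon$. For a positive element $a$ and $\varepsilon>0$, $(a-\varepsilon)_+$ is the element $f(a)$ obtained by functional calculus with $f(t)=\max(0,t-\varepsilon)$. $M_\infty(A)$ is the algebraic inductive limit (union) of the matrix algebras $M_n(A)$ under upper left-hand corner embeddings; for positive $a,b\in M_\infty(A)$, $a\precsim b$ ($a$ is Cuntz subequivalent to $b$) means that there is a sequence $(v_n)$ in $M_\infty(A)$ with $\|v_nbv_n^*-a\|\to 0$. Definition of $\mathrm{gTA}\Omega$. Let $\Omega$ be a class of $C^*$-algebras. A simple $C^*$-algebra $A$ belongs to $\mathrm{gTA}\Omega$ if for any $\varepsilon>0$, every finite set $F\subseteq A$, and every pair of positive elements $a,y\in A$ with $a\neq 0$, there exist a $C^*$-subalgebra $B$ of $A$ with $B\in\Omega$ and a positive element $g\in B$ with $\|g\|\le 1$ such that: (1) $\|xg-gx\|<\varepsilon$ for all $x\in F$; (2) $gx\in_\varepsilon B$ and $xg\in_\varepsilon B$ for all $x\in F$; (3) $(y^2-ygy-\varepsilon)_+\precsim a$; and (4) $\|gag\|\ge\|a\|-\varepsilon$. Definition of $\mathrm{WTA}\Omega$. Let $\Omega$ be a class of unital $C^*$-algebras. A simple unital $C^*$-algebra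 $A$ belongs to $\mathrm{WTA}\Omega$ if for any $\varepsilon>0$, any finite subset $F\subseteq A$, and any non-zero element $a\ge 0$ of $A$, there exist a projection $p\in A$, an element $g\in A$ with $0\le g\le 1$, and a unital $C^*$-subalgebra $B$ of $A$ (whose unit $1_B$ need not be the unit of $A$) with $g\in B$, $1_B=p$, and $B\in\Omega$, such that: (1) $(p-g)x\in_\varepsilon B$ and $x(p-g)\in_\varepsilon B$ for all $x\in F$; (2) $\|(p-g)x-x(p-g)\|<\varepsilon$ for all $x\in F$; (3) $1-(p-g)\precsim a$; and (4) $\|(p-g)a(p-g)\|\ge\|a\|-\varepsilon$. *)

theory Defs
  imports
    "HOL-Analysis.Analysis"
    "HOL-Computational_Algebra.Polynomial"
    "HOL-Library.Groups_Big_Fun"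
begin

section \<open>\<open>C\<^sup>*\<close>-algebras\<close>

class cstar_algebra = real_normed_algebra + banach +
  fixes scaleC :: "complex \<Rightarrow> 'a \<Rightarrow> 'a"  (infixr "*\<^sub>C" 75)
    and adj :: "'a \<Rightarrow> 'a"
  assumes scaleC_add_right: "c *\<^sub>C (x + y) = c *\<^sub>C x + c *\<^sub>C y"
    and scaleC_add_left: "(c + d) *\<^sub>C x = c *\<^sub>C x + d *\<^sub>C x"
    and scaleC_scaleC: "c *\<^sub>C d *\<^sub>C x = (c * d) *\<^sub>C x"
    and scaleR_scaleC: "r *\<^sub>R x = complex_of_real r *\<^sub>C x"
    and mult_scaleC_left: "(c *\<^sub>C x) * y = c *\<^sub>C (x * y)"
    and mult_scaleC_right: "x * (c *\<^sub>C y) = c *\<^sub>C (x * y)"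
    and norm_scaleC: "norm (c *\<^sub>C x) = cmod c * norm x"
    and adj_add: "adj (x + y) = adj x + adj y"
    and adj_scaleC: "adj (c *\<^sub>C x) = cnj c *\<^sub>C adj x"
    and adj_mult: "adj (x * y) = adj y * adj x"
    and adj_adj: "adj (adj x) = x"
    and cstar_identity: "norm (adj x * x) = (norm x)\<^sup>2"

text \<open>The unital algebras of this class are the nonzero ones; there \<open>norm 1 = 1\<close> is automatic.\<close>

class unital_cstar_algebra = cstar_algebra + real_normed_algebra_1

definition closed_ideal :: "'a::cstar_algebra set \<Rightarrow> bool" where
  "closed_ideal I \<longleftrightarrow> closed I \<and> 0 \<in> I \<and> (\<forall>x\<in>I. \<forall>y\<in>I. x + y \<in> I) \<and>
     (\<forall>c. \<forall>x\<in>I. c *\<^sub>C x \<in> I) \<and> (\<forall>a. \<forall>x\<in>I. a * x \<in> I \<and> x * a \<in> I)"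

definition simple_cstar :: "'a::cstar_algebra itself \<Rightarrow> bool" where
  "simple_cstar A \<longleftrightarrow> (UNIV :: 'a set) \<noteq> {0} \<and>
     (\<forall>I :: 'a set. closed_ideal I \<longrightarrow> I = {0} \<or> I = UNIV)"

definition cstar_subalgebra :: "'a::cstar_algebra set \<Rightarrow> bool" where
  "cstar_subalgebra B \<longleftrightarrow> closed B \<and> 0 \<in> B \<and> (\<forall>x\<in>B. \<forall>y\<in>B. x + y \<in> B \<and> x * y \<in> B) \<and>
     (\<forall>c. \<forall>x\<in>B. c *\<^sub>C x \<in> B) \<and> (\<forall>x\<in>B. adj x \<in> B)"

definition is_unit_of :: "'a::cstar_algebra \<Rightarrow> 'a set \<Rightarrow> bool" where
  "is_unit_of e B \<longleftrightarrow> e \<in> B \<and> (\<forall>x\<in>B. e * x = x \<and> x * e = x)"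


section \<open>Classes of \<open>C\<^sup>*\<close>-algebras\<close>

text \<open>
  A class of \<open>C\<^sup>*\<close>-algebras is a set of explicit structures, each with its own carrier and
  operations.  A \<open>C\<^sup>*\<close>-subalgebra of a type in class \<open>cstar_algebra\<close> belongs to the class when the
  structure it inherits (\<open>structure_of\<close>) does.  Closure under isomorphism is not required.
\<close>

record 'a cstar_structure =
  cs_carrier :: "'a set"
  cs_zero :: 'a
  cs_add :: "'a \<Rightarrow> 'a \<Rightarrow> 'a"
  cs_scale :: "complex \<Rightarrow> 'a \<Rightarrow> 'a"
  cs_mult :: "'a \<Rightarrow> 'a \<Rightarrow> 'a"
  cs_adj :: "'a \<Rightarrow> 'a"
  cs_norm :: "'a \<Rightarrow> real"

locale cstar =
  fixes C :: "'a cstar_structure"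
  assumes zero_closed: "cs_zero C \<in> cs_carrier C"
    and add_closed: "\<lbrakk>x \<in> cs_carrier C; y \<in> cs_carrier C\<rbrakk> \<Longrightarrow> cs_add C x y \<in> cs_carrier C"
    and scale_closed: "x \<in> cs_carrier C \<Longrightarrow> cs_scale C c x \<in> cs_carrier C"
    and mult_closed: "\<lbrakk>x \<in> cs_carrier C; y \<in> cs_carrier C\<rbrakk> \<Longrightarrow> cs_mult C x y \<in> cs_carrier C"
    and adj_closed: "x \<in> cs_carrier C \<Longrightarrow> cs_adj C x \<in> cs_carrier C"
    and add_assoc: "\<lbrakk>x \<in> cs_carrier C; y \<in> cs_carrier C; z \<in> cs_carrier C\<rbrakk> \<Longrightarrow>
          cs_add C (cs_add C x y) z = cs_add C x (cs_add C y z)"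
    and add_commute: "\<lbrakk>x \<in> cs_carrier C; y \<in> cs_carrier C\<rbrakk> \<Longrightarrow> cs_add C x y = cs_add C y x"
    and add_zero: "x \<in> cs_carrier C \<Longrightarrow> cs_add C x (cs_zero C) = x"
    and add_neg: "x \<in> cs_carrier C \<Longrightarrow> cs_add C x (cs_scale C (-1) x) = cs_zero C"
    and scale_one: "x \<in> cs_carrier C \<Longrightarrow> cs_scale C 1 x = x"
    and scale_scale: "x \<in> cs_carrier C \<Longrightarrow> cs_scale C c (cs_scale C d x) = cs_scale C (c * d) x"
    and scale_add_right: "\<lbrakk>x \<in> cs_carrier C; y \<in> cs_carrier C\<rbrakk> \<Longrightarrow>
          cs_scale C c (cs_add C x y) = cs_add C (cs_scale C c x) (cs_scale C c y)"
    and scale_add_left: "x \<in> cs_carrier C \<Longrightarrow>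
          cs_scale C (c + d) x = cs_add C (cs_scale C c x) (cs_scale C d x)"
    and mult_assoc: "\<lbrakk>x \<in> cs_carrier C; y \<in> cs_carrier C; z \<in> cs_carrier C\<rbrakk> \<Longrightarrow>
          cs_mult C (cs_mult C x y) z = cs_mult C x (cs_mult C y z)"
    and mult_add_left: "\<lbrakk>x \<in> cs_carrier C; y \<in> cs_carrier C; z \<in> cs_carrier C\<rbrakk> \<Longrightarrow>
          cs_mult C (cs_add C x y) z = cs_add C (cs_mult C x z) (cs_mult C y z)"
    and mult_add_right: "\<lbrakk>x \<in> cs_carrier C; y \<in> cs_carrier C; z \<in> cs_carrier C\<rbrakk> \<Longrightarrow>
          cs_mult C x (cs_add C y z) = cs_add C (cs_mult C x y) (cs_mult C x z)"
    and mult_scale_left: "\<lbrakk>x \<in> cs_carrier C; y \<in> cs_carrier C\<rbrakk> \<Longrightarrow>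
          cs_mult C (cs_scale C c x) y = cs_scale C c (cs_mult C x y)"
    and mult_scale_right: "\<lbrakk>x \<in> cs_carrier C; y \<in> cs_carrier C\<rbrakk> \<Longrightarrow>
          cs_mult C x (cs_scale C c y) = cs_scale C c (cs_mult C x y)"
    and adj_add: "\<lbrakk>x \<in> cs_carrier C; y \<in> cs_carrier C\<rbrakk> \<Longrightarrow>
          cs_adj C (cs_add C x y) = cs_add C (cs_adj C x) (cs_adj C y)"
    and adj_scale: "x \<in> cs_carrier C \<Longrightarrow> cs_adj C (cs_scale C c x) = cs_scale C (cnj c) (cs_adj C x)"
    and adj_mult: "\<lbrakk>x \<in> cs_carrier C; y \<in> cs_carrier C\<rbrakk> \<Longrightarrow>
          cs_adj C (cs_mult C x y) = cs_mult C (cs_adj C y) (cs_adj C x)"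
    and adj_adj: "x \<in> cs_carrier C \<Longrightarrow> cs_adj C (cs_adj C x) = x"
    and norm_nonneg: "x \<in> cs_carrier C \<Longrightarrow> 0 \<le> cs_norm C x"
    and norm_eq_zero: "x \<in> cs_carrier C \<Longrightarrow> cs_norm C x = 0 \<longleftrightarrow> x = cs_zero C"
    and norm_triangle: "\<lbrakk>x \<in> cs_carrier C; y \<in> cs_carrier C\<rbrakk> \<Longrightarrow>
          cs_norm C (cs_add C x y) \<le> cs_norm C x + cs_norm C y"
    and norm_scale: "x \<in> cs_carrier C \<Longrightarrow> cs_norm C (cs_scale C c x) = cmod c * cs_norm C x"
    and norm_mult: "\<lbrakk>x \<in> cs_carrier C; y \<in> cs_carrier C\<rbrakk> \<Longrightarrow>
          cs_norm C (cs_mult C x y) \<le> cs_norm C x * cs_norm C y"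
    and norm_adj_mult: "x \<in> cs_carrier C \<Longrightarrow> cs_norm C (cs_mult C (cs_adj C x) x) = (cs_norm C x)\<^sup>2"
    and complete: "\<lbrakk>\<And>n::nat. s n \<in> cs_carrier C;
          \<And>e. e > 0 \<Longrightarrow> \<exists>N. \<forall>m\<ge>N. \<forall>n\<ge>N. cs_norm C (cs_add C (s m) (cs_scale C (-1) (s n))) < e\<rbrakk> \<Longrightarrow>
          \<exists>l\<in>cs_carrier C. (\<lambda>n. cs_norm C (cs_add C (s n) (cs_scale C (-1) l))) \<longlonglongrightarrow> 0"

locale unital_cstar = cstar +
  assumes unit_ex: "\<exists>e\<in>cs_carrier C. \<forall>x\<in>cs_carrier C. cs_mult C e x = x \<and> cs_mult C x e = x"

definition structure_of :: "'a::cstar_algebra set \<Rightarrow> 'a cstar_structure" where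
  "structure_of B = \<lparr>cs_carrier = B, cs_zero = 0, cs_add = (+), cs_scale = scaleC, cs_mult = (*),
     cs_adj = adj, cs_norm = norm\<rparr>"

lemma scaleC_one: "1 *\<^sub>C x = (x :: 'a::cstar_algebra)"
  using scaleR_scaleC[of 1 x] by simp

lemma scaleC_minus_one: "(-1) *\<^sub>C x = - (x :: 'a::cstar_algebra)"
  using scaleR_scaleC[of "-1" x] by simp

lemma cstar_structure_of:
  assumes "cstar_subalgebra (B :: 'a::cstar_algebra set)"
  shows "cstar (structure_of B)"
proof
  fix s :: "nat \<Rightarrow> 'a"
  let ?C = "structure_of B"
  assume s: "\<And>n. s n \<in> cs_carrier ?C"
    and cau: "\<And>e. e > 0 \<Longrightarrow> \<exists>N. \<forall>m\<ge>N. \<forall>n\<ge>N. cs_norm ?C (cs_add ?C (s m) (cs_scale ?C (-1) (s n))) < e"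
  have "Cauchy s"
    unfolding Cauchy_def dist_norm using cau by (simp add: structure_of_def scaleC_minus_one)
  then obtain l where l: "s \<longlonglongrightarrow> l"
    using Cauchy_convergent convergent_def by blast
  have "closed B" and "\<And>n. s n \<in> B"
    using assms s by (auto simp: cstar_subalgebra_def structure_of_def)
  with l have "l \<in> B"
    using closed_sequentially by blast
  moreover have "(\<lambda>n. norm (s n - l)) \<longlonglongrightarrow> 0"
    using l by (simp add: LIM_zero_iff tendsto_norm_zero_iff)
  ultimately show "\<exists>l\<in>cs_carrier ?C. (\<lambda>n. cs_norm ?C (cs_add ?C (s n) (cs_scale ?C (-1) l))) \<longlonglongrightarrow> 0"
    by (auto simp: structure_of_def scaleC_minus_one)
qed (use assms in \<open>auto simp: structure_of_def cstar_subalgebra_def algebra_simps scaleC_one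
      scaleC_minus_one scaleC_add_right scaleC_add_left scaleC_scaleC mult_scaleC_left
      mult_scaleC_right norm_scaleC cstar_algebra_class.adj_add adj_scaleC
      cstar_algebra_class.adj_mult cstar_algebra_class.adj_adj cstar_identity
      norm_triangle_ineq norm_mult_ineq\<close>)

lemma unital_cstar_structure_of:
  assumes "cstar_subalgebra B"
  shows "unital_cstar (structure_of B) \<longleftrightarrow> (\<exists>e. is_unit_of e B)"
  using cstar_structure_of[OF assms]
  by (auto simp: unital_cstar_def unital_cstar_axioms_def is_unit_of_def structure_of_def)


section \<open>Positivity and functional calculus\<close>

definition positive_in :: "'a::cstar_algebra set \<Rightarrow> 'a \<Rightarrow> bool" where
  "positive_in B a \<longleftrightarrow> (\<exists>b\<in>B. a = adj b * b)"

abbreviation positive :: "'a::cstar_algebra \<Rightarrow> bool" where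
  "positive \<equiv> positive_in UNIV"

text \<open>
  The spectrum of \<open>a\<close> in the unitization, which contains \<open>0\<close>: for \<open>z \<noteq> 0\<close> and \<open>u = z\<^sup>-\<^sup>1 a\<close>, the
  element \<open>1 - b\<close> is a two-sided inverse of \<open>1 - u\<close> iff \<open>u + b - u b = 0 = u + b - b u\<close>.  In a
  unital algebra this is the usual spectrum together with \<open>0\<close>, which does not affect the
  calculus below because only functions vanishing at \<open>0\<close> are used.
\<close>

definition spectrum :: "'a::cstar_algebra \<Rightarrow> complex set" where
  "spectrum a = insert 0 {z. z \<noteq> 0 \<and>
     \<not> (\<exists>b. inverse z *\<^sub>C a + b - (inverse z *\<^sub>C a) * b = 0 \<and>
            inverse z *\<^sub>C a + b - b * (inverse z *\<^sub>C a) = 0)}"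

text \<open>\<open>p(a)\<close> for a polynomial \<open>p\<close> without constant term; \<open>((*) a ^^ i) a\<close> is \<open>a\<close> to the power \<open>i + 1\<close>.\<close>

definition poly_calc :: "complex poly \<Rightarrow> 'a::cstar_algebra \<Rightarrow> 'a" where
  "poly_calc p a = (\<Sum>i<degree p. coeff p (Suc i) *\<^sub>C ((*) a ^^ i) a)"

text \<open>
  Continuous functional calculus of a self-adjoint \<open>a\<close> at a continuous \<open>f\<close> with \<open>f 0 = 0\<close>: the
  limit of \<open>p\<^sub>n(a)\<close> for polynomials \<open>p\<^sub>n\<close> vanishing at \<open>0\<close> that converge to \<open>f\<close> uniformly
  on the spectrum.
\<close>

definition fun_calc :: "(complex \<Rightarrow> complex) \<Rightarrow> 'a::cstar_algebra \<Rightarrow> 'a" where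
  "fun_calc f a = (THE b. \<exists>p :: nat \<Rightarrow> complex poly.
     (\<forall>n. poly (p n) 0 = 0) \<and>
     uniform_limit (spectrum a) (\<lambda>n. poly (p n)) f sequentially \<and>
     (\<lambda>n. poly_calc (p n) a) \<longlonglongrightarrow> b)"

text \<open>\<open>cut_down a \<epsilon>\<close> is \<open>(a - \<epsilon>)\<^sub>+\<close>.\<close>

definition cut_down :: "'a::cstar_algebra \<Rightarrow> real \<Rightarrow> 'a" where
  "cut_down a \<epsilon> = fun_calc (\<lambda>z. complex_of_real (max 0 (Re z - \<epsilon>))) a"


section \<open>Cuntz subequivalence\<close>

text \<open>
  The algebraic limit \<open>M\<^sub>\<infinity>(A)\<close> consists of the infinite matrices with finitely many nonzero entries.
  Its norm is the operator norm on finitely supported columns, where a column \<open>x\<close> has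
  the Hilbert-module norm \<open>\<parallel>\<Sum>\<^sub>i x\<^sub>i\<^sup>* x\<^sub>i\<parallel>\<^sup>1\<^sup>/\<^sup>2\<close>.  On each \<open>M\<^sub>n(A)\<close> this is the unique
  \<open>C\<^sup>*\<close>-norm, since \<open>M\<^sub>n(A)\<close> acts faithfully by adjointable operators on the Hilbert module \<open>A\<^sup>n\<close>.
\<close>

type_synonym 'a inf_matrix = "nat \<Rightarrow> nat \<Rightarrow> 'a"

definition M_infty :: "'a::cstar_algebra inf_matrix set" where
  "M_infty = {S. finite {(i, j). S i j \<noteq> 0}}"

definition mat_mult :: "'a::cstar_algebra inf_matrix \<Rightarrow> 'a inf_matrix \<Rightarrow> 'a inf_matrix" where
  "mat_mult S T = (\<lambda>i j. Sum_any (\<lambda>k. S i k * T k j))"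

definition mat_adj :: "'a::cstar_algebra inf_matrix \<Rightarrow> 'a inf_matrix" where
  "mat_adj S = (\<lambda>i j. adj (S j i))"

definition col_norm :: "(nat \<Rightarrow> 'a::cstar_algebra) \<Rightarrow> real" where
  "col_norm x = sqrt (norm (Sum_any (\<lambda>i. adj (x i) * x i)))"

definition mat_norm :: "'a::cstar_algebra inf_matrix \<Rightarrow> real" where
  "mat_norm S = (SUP x\<in>{x. finite {i. x i \<noteq> 0} \<and> col_norm x \<le> 1}.
     col_norm (\<lambda>i. Sum_any (\<lambda>j. S i j * x j)))"

definition cuntz_sub :: "'a::cstar_algebra inf_matrix \<Rightarrow> 'a inf_matrix \<Rightarrow> bool" where
  "cuntz_sub S T \<longleftrightarrow> (\<exists>v :: nat \<Rightarrow> 'a inf_matrix. (\<forall>n. v n \<in> M_infty) \<and>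
     (\<lambda>n. mat_norm (mat_mult (mat_mult (v n) T) (mat_adj (v n)) - S)) \<longlonglongrightarrow> 0)"

definition corner :: "'a::cstar_algebra \<Rightarrow> 'a inf_matrix" where
  "corner a = (\<lambda>i j. if i = 0 \<and> j = 0 then a else 0)"

abbreviation cuntz_le :: "'a::cstar_algebra \<Rightarrow> 'a \<Rightarrow> bool"  (infix "\<precsim>" 50) where
  "a \<precsim> b \<equiv> cuntz_sub (corner a) (corner b)"


section \<open>The approximation classes\<close>

definition approx_in :: "'a::cstar_algebra \<Rightarrow> real \<Rightarrow> 'a set \<Rightarrow> bool" where
  "approx_in x \<epsilon> B \<longleftrightarrow> (\<exists>b\<in>B. norm (x - b) < \<epsilon>)"

text \<open>\<open>gTA \<Omega> TYPE('a)\<close> and \<open>WTA \<Omega> TYPE('a)\<close> say that the algebra \<open>'a\<close> belongs to \<open>gTA\<Omega>\<close>, \<open>WTA\<Omega>\<close>.\<close>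

definition gTA :: "'a::cstar_algebra cstar_structure set \<Rightarrow> 'a itself \<Rightarrow> bool" where
  "gTA \<Omega> A \<longleftrightarrow> simple_cstar A \<and>
     (\<forall>\<epsilon>>0. \<forall>F :: 'a set. finite F \<longrightarrow> (\<forall>a y :: 'a. positive a \<and> positive y \<and> a \<noteq> 0 \<longrightarrow>
       (\<exists>B g. cstar_subalgebra B \<and> structure_of B \<in> \<Omega> \<and> g \<in> B \<and> positive_in B g \<and> norm g \<le> 1 \<and>
          (\<forall>x\<in>F. norm (x * g - g * x) < \<epsilon>) \<and>
          (\<forall>x\<in>F. approx_in (g * x) \<epsilon> B \<and> approx_in (x * g) \<epsilon> B) \<and>
          cut_down (y * y - y * g * y) \<epsilon> \<precsim> a \<and>
          norm (g * a * g) \<ge> norm a - \<epsilon>)))"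

definition WTA :: "'a::unital_cstar_algebra cstar_structure set \<Rightarrow> 'a itself \<Rightarrow> bool" where
  "WTA \<Omega> A \<longleftrightarrow> simple_cstar A \<and>
     (\<forall>\<epsilon>>0. \<forall>F :: 'a set. finite F \<longrightarrow> (\<forall>a :: 'a. positive a \<and> a \<noteq> 0 \<longrightarrow>
       (\<exists>p g B. adj p = p \<and> p * p = p \<and> positive g \<and> positive (1 - g) \<and>
          cstar_subalgebra B \<and> is_unit_of p B \<and> structure_of B \<in> \<Omega> \<and> g \<in> B \<and>
          (\<forall>x\<in>F. approx_in ((p - g) * x) \<epsilon> B \<and> approx_in (x * (p - g)) \<epsilon> B) \<and>
          (\<forall>x\<in>F. norm ((p - g) * x - x * (p - g)) < \<epsilon>) \<and>
          1 - (p - g) \<precsim> a \<and>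
          norm ((p - g) * a * (p - g)) \<ge> norm a - \<epsilon>)))"

end

theory Submission
  imports Defs "HOL-Computational_Algebra.Fundamental_Theorem_Algebra"
begin

text \<open>
  Given \<open>g \<in> B\<close> as in the definition of \<open>gTA\<Omega>\<close> for \<open>y = 1\<close>, let \<open>h = f(g)\<close> with
  \<open>f(t) = min 1 (t / (1 - \<epsilon>))\<close>.  Then \<open>h\<close> is close to \<open>g\<close> and
  \<open>1 - h = (1 - \<epsilon>)\<^sup>-\<^sup>1 (1 - g - \<epsilon>)\<^sub>+ \<precsim> a\<close>, so the unit \<open>p\<close> of \<open>B\<close> together with \<open>p - h\<close> witnesses
  \<open>WTA\<Omega>\<close>.  Conversely, \<open>h = p - g\<close> witnesses \<open>gTA\<Omega>\<close>, because
  \<open>(y\<^sup>2 - y h y - \<epsilon>)\<^sub>+ = (y (1 - h) y - \<epsilon>)\<^sub>+\<close> is of the form \<open>w (1 - h) w\<^sup>*\<close>.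
\<close>

section \<open>Adjoints and inverses\<close>

text \<open>The obstacle in passing to WTA\<Omega> is that gTA\<Omega> controls only a cut-down of
  \<open>1 - g\<close>, while WTA\<Omega> compares \<open>1 - (p - g)\<close> itself with
  \<open>a\<close>. The stretch \<open>f\<close> absorbs the cut-down, since \<open>1 - f(t)\<close>
  is the cut-down of \<open>1 - t\<close> up to a scalar. Using \<open>p - h\<close> as witness then
  undoes the subtraction, as \<open>p - (p - h) = h\<close>. Most of the text prepares this short
  argument: a calculus for one self-adjoint element that stays inside a subalgebra with its own
  unit, the equivalence of spectral positivity with the form \<open>adj b * b\<close>, and Cuntz
  comparison by elements instead of matrices. The calculus rests on real polynomials and on one
  analytic fact: the norm of a self-adjoint element is, up to sign, one of its spectral values. This
  follows from elementary estimates of inverses and the C*-identity.\<close>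

lemma adj_0 [simp]: "adj (0::'a::cstar_algebra) = 0"
  using adj_add[of 0 "0::'a"] by simp

lemma adj_minus: "adj (- x) = - adj (x::'a::cstar_algebra)"
  using adj_add[of x "- x"] by (simp add: eq_neg_iff_add_eq_0 add.commute)

lemma adj_diff: "adj (x - y) = adj x - adj (y::'a::cstar_algebra)"
  using adj_add[of x "- y"] by (simp add: adj_minus)

lemma adj_scaleR: "adj (r *\<^sub>R x) = r *\<^sub>R adj (x::'a::cstar_algebra)"
  by (simp add: scaleR_scaleC adj_scaleC)

text \<open>The C*-identity and submultiplicativity give
  \<open>(norm z)\<^sup>2 \<le> norm (adj z) * norm z\<close>, so no element is longer than its
  adjoint; this is applied to \<open>x\<close> and to \<open>adj x\<close>.\<close>

lemma norm_adj [simp]: "norm (adj x) = norm (x::'a::cstar_algebra)"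
proof -
  have *: "norm z \<le> norm (adj z)" for z :: 'a
  proof (cases "norm z = 0")
    case False
    have "norm z * norm z \<le> norm (adj z) * norm z"
      using cstar_identity[of z] norm_mult_ineq[of "adj z" z] by (simp add: power2_eq_square)
    with False show ?thesis
      by (metis mult_right_le_imp_le norm_ge_zero order_less_le)
  qed simp
  show ?thesis
    using *[of x] *[of "adj x"] by (simp add: adj_adj)
qed

lemma bounded_linear_adj: "bounded_linear (adj :: 'a::cstar_algebra \<Rightarrow> 'a)"
  by (rule bounded_linear_intro[where K = 1]) (auto simp: adj_add adj_scaleR)

lemma adj_1 [simp]: "adj (1::'a::unital_cstar_algebra) = 1"
  by (metis adj_adj adj_mult mult_1 mult_1_right)

lemma adj_power: "adj (x ^ n) = adj (x::'a::unital_cstar_algebra) ^ n"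
  by (induction n) (simp_all add: adj_mult power_commutes)

lemma norm_square_selfadj:
  assumes "adj x = (x::'a::cstar_algebra)"
  shows "norm (x * x) = (norm x)\<^sup>2"
  using cstar_identity[of x] assms by simp

text \<open>The C*-identity doubles the exponent, hence the powers of two. They are the powers met
  when \<open>x\<close> is squared repeatedly in the spectral radius argument.\<close>

lemma norm_power_selfadj:
  assumes "adj x = (x::'a::unital_cstar_algebra)"
  shows "norm (x ^ (2 ^ m)) = norm x ^ (2 ^ m)"
proof (induction m)
  case (Suc m)
  have "norm (x ^ 2 ^ Suc m) = norm (x ^ 2 ^ m * x ^ 2 ^ m)"
    by (simp add: power_add[symmetric] mult_2)
  also have "\<dots> = (norm (x ^ 2 ^ m))\<^sup>2"
    by (rule norm_square_selfadj) (simp add: adj_power assms)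
  finally show ?case
    by (simp add: Suc power_mult[symmetric] mult.commute)
qed simp

lemma scaleC_0_right [simp]: "c *\<^sub>C (0::'a::cstar_algebra) = 0"
  using scaleC_add_right[of c 0 "0::'a"] by simp

lemma scaleC_0_left [simp]: "0 *\<^sub>C (x::'a::cstar_algebra) = 0"
  using scaleC_add_left[of 0 0 x] by simp

lemma scaleC_minus_left: "(- c) *\<^sub>C x = - (c *\<^sub>C (x::'a::cstar_algebra))"
  using scaleC_add_left[of c "- c" x] by (simp add: eq_neg_iff_add_eq_0 add.commute)

lemma scaleC_minus_right: "c *\<^sub>C (- x) = - (c *\<^sub>C (x::'a::cstar_algebra))"
  using scaleC_add_right[of c x "- x"] by (simp add: eq_neg_iff_add_eq_0 add.commute)

lemma scaleC_diff_right: "c *\<^sub>C (x - y) = c *\<^sub>C x - c *\<^sub>C (y::'a::cstar_algebra)"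
  using scaleC_add_right[of c x "- y"] by (simp add: scaleC_minus_right)

lemma scaleC_diff_left: "(c - d) *\<^sub>C x = c *\<^sub>C x - d *\<^sub>C (x::'a::cstar_algebra)"
  using scaleC_add_left[of c "- d" x] by (simp add: scaleC_minus_left)

section \<open>Two-sided inverses and the Neumann series\<close>

definition isinv :: "'a::monoid_mult \<Rightarrow> 'a \<Rightarrow> bool" where
  "isinv x b \<longleftrightarrow> x * b = 1 \<and> b * x = 1"

definition invble :: "'a::monoid_mult \<Rightarrow> bool" where
  "invble x \<longleftrightarrow> (\<exists>b. isinv x b)"

lemma invble_mult: "invble x \<Longrightarrow> invble y \<Longrightarrow> invble (x * y)"
  unfolding invble_def isinv_def by (metis mult.assoc mult_1_right)

lemma invble_1 [simp]: "invble 1"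
  unfolding invble_def isinv_def by (metis mult_1)

lemma invble_scaleC:
  assumes "c \<noteq> 0" "invble (x::'a::unital_cstar_algebra)"
  shows "invble (c *\<^sub>C x)"
proof -
  obtain b where "x * b = 1" "b * x = 1"
    using assms(2) by (auto simp: invble_def isinv_def)
  then have "isinv (c *\<^sub>C x) (inverse c *\<^sub>C b)"
    using assms(1)
    by (simp add: isinv_def mult_scaleC_left mult_scaleC_right scaleC_scaleC scaleC_one)
  then show ?thesis
    by (auto simp: invble_def)
qed

lemma invble_minus: "invble (- x) \<longleftrightarrow> invble (x::'a::ring_1)"
  unfolding invble_def isinv_def by (metis minus_mult_minus minus_minus)

lemma invble_scaleR:
  assumes "c \<noteq> 0" "invble (x::'a::unital_cstar_algebra)"
  shows "invble (c *\<^sub>R x)"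
  using invble_scaleC[of "complex_of_real c" x] assms by (simp add: scaleR_scaleC)

text \<open>Neumann series: splitting off the first term shows
  \<open>s = 1 + x * s = 1 + s * x\<close> for its sum \<open>s\<close>.\<close>

lemma invble_one_minus:
  fixes x :: "'a::{real_normed_algebra_1,banach}"
  assumes "norm x < 1"
  shows "invble (1 - x)"
proof -
  have s: "summable (\<lambda>n. x ^ n)"
    by (rule summable_comparison_test[OF _ summable_geometric[of "norm x"]])
       (use assms norm_power_ineq in auto)
  have "suminf (\<lambda>n. x ^ n) = x ^ 0 + suminf (\<lambda>n. x ^ Suc n)"
    using suminf_split_head[OF s] by simp
  moreover have "suminf (\<lambda>n. x ^ Suc n) = x * suminf (\<lambda>n. x ^ n)"
    using suminf_mult[OF s, of x] by simp
  moreover have "suminf (\<lambda>n. x ^ Suc n) = suminf (\<lambda>n. x ^ n) * x"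
    using suminf_mult2[OF s, of x] by (simp add: power_commutes)
  ultimately have "isinv (1 - x) (suminf (\<lambda>n. x ^ n))"
    by (simp add: isinv_def algebra_simps)
  then show ?thesis
    by (auto simp: invble_def)
qed

lemma invble_scalar_minus:
  fixes x :: "'a::unital_cstar_algebra"
  assumes "norm x < cmod z"
  shows "invble (z *\<^sub>C 1 - x)"
proof -
  have z: "z \<noteq> 0"
    using assms by auto
  have "norm (inverse z *\<^sub>C x) < 1"
    using mult_strict_left_mono[OF assms, of "inverse (cmod z)"] z
    by (simp add: norm_scaleC norm_inverse)
  then have "invble (z *\<^sub>C (1 - inverse z *\<^sub>C x))"
    using z by (intro invble_scaleC invble_one_minus)
  then show ?thesis
    using z by (simp add: scaleC_diff_right scaleC_scaleC scaleC_one)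
qed

section \<open>Spectral radius of self-adjoint elements\<close>

text \<open>Arens' trick: adding \<open>i t\<close> shifts the spectrum by \<open>t\<close>, but lengthens the element only to \<open>sqrt (\<parallel>c\<parallel>\<^sup>2 + t\<^sup>2)\<close>.\<close>

lemma invble_add_imaginary:
  fixes c :: "'a::unital_cstar_algebra"
  assumes "adj c = c" "\<beta> \<noteq> 0"
  shows "invble (c + (\<i> * complex_of_real \<beta>) *\<^sub>C 1)"
proof (rule ccontr)
  assume n: "\<not> ?thesis"
  have le: "(t + \<beta>)\<^sup>2 \<le> (norm c)\<^sup>2 + t\<^sup>2" for t :: real
  proof -
    define w where "w = c - (\<i> * complex_of_real t) *\<^sub>C 1"
    have "adj w = c + (\<i> * complex_of_real t) *\<^sub>C 1"
      by (simp add: w_def adj_diff adj_scaleC assms scaleC_minus_left)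
    then have "adj w * w = c * c + (t\<^sup>2) *\<^sub>R 1"
      by (simp add: w_def algebra_simps mult_scaleC_left mult_scaleC_right scaleC_scaleC
          scaleR_scaleC power2_eq_square scaleC_diff_right scaleC_add_right scaleC_minus_left)
    then have "(norm w)\<^sup>2 = norm (c * c + (t\<^sup>2) *\<^sub>R 1)"
      using cstar_identity[of w] by simp
    also have "\<dots> \<le> (norm c)\<^sup>2 + t\<^sup>2"
      using norm_triangle_ineq[of "c * c" "(t\<^sup>2) *\<^sub>R 1"] norm_square_selfadj[OF assms(1)] by simp
    finally have w: "(norm w)\<^sup>2 \<le> (norm c)\<^sup>2 + t\<^sup>2" .
    \<comment> \<open>At this point \<open>z *\<^sub>C 1 - w\<close> is, up to sign, the element
      supposed not to be invertible, so \<open>cmod z\<close> cannot exceed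
      \<open>norm w\<close>.\<close>
    define z where "z = - (\<i> * complex_of_real (t + \<beta>))"
    have "z *\<^sub>C 1 - w = - (c + (\<i> * complex_of_real \<beta>) *\<^sub>C 1)"
      by (simp add: z_def w_def scaleC_diff_left scaleC_minus_left scaleC_add_left distrib_left)
    then have "\<not> invble (z *\<^sub>C 1 - w)"
      using n invble_minus by metis
    then have "cmod z \<le> norm w"
      using invble_scalar_minus[of w z] by fastforce
    then have "\<bar>t + \<beta>\<bar> \<le> norm w"
      by (simp only: z_def norm_minus_cancel norm_mult norm_of_real norm_ii) simp
    then have "(t + \<beta>)\<^sup>2 \<le> (norm w)\<^sup>2"
      by (metis abs_ge_zero power2_abs power_mono)
    with w show ?thesis
      by simp
  qed
  \<comment> \<open>This choice of \<open>t\<close> makes \<open>2 * t * \<beta>\<close> equal to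
    the square of \<open>norm c\<close>, which leaves
    \<open>\<beta>\<^sup>2 \<le> 0\<close>.\<close>
  have "2 * ((norm c)\<^sup>2 / (2 * \<beta>)) * \<beta> + \<beta>\<^sup>2 \<le> (norm c)\<^sup>2"
    using le[of "(norm c)\<^sup>2 / (2 * \<beta>)"] by (simp add: power2_sum)
  then show False
    using assms(2) by (simp add: field_simps)
qed

text \<open>Factor as \<open>(c + i \<beta>) (c - i \<beta>)\<close>. This handles the irreducible
  real quadratic factors of a polynomial and the spectrum of a square.\<close>

lemma invble_square_add:
  fixes c :: "'a::unital_cstar_algebra"
  assumes "adj c = c" "\<beta> \<noteq> 0"
  shows "invble (c * c + \<beta>\<^sup>2 *\<^sub>R 1)"
proof -
  let ?u = "c + (\<i> * complex_of_real \<beta>) *\<^sub>C 1" and ?v = "c + (\<i> * complex_of_real (- \<beta>)) *\<^sub>C 1"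
  have "c * c + \<beta>\<^sup>2 *\<^sub>R 1 = ?u * ?v"
    by (simp add: algebra_simps mult_scaleC_left mult_scaleC_right scaleC_scaleC
          scaleR_scaleC power2_eq_square scaleC_add_right scaleC_minus_left)
  also have "invble \<dots>"
    using assms by (intro invble_mult invble_add_imaginary) auto
  finally show ?thesis .
qed

section \<open>Perturbation of inverses\<close>

lemma inverse_diff_eq:
  fixes u v :: "'a::ring_1"
  assumes "isinv u u'" "isinv v v'"
  shows "u' - v' = u' * (v - u) * v'"
proof -
  have "v * v' = 1" "u' * u = 1"
    using assms by (auto simp: isinv_def)
  then show ?thesis
    by (simp add: algebra_simps)
qed

lemma isinv_one_minus_square:
  fixes y :: "'a::real_algebra_1"
  assumes "isinv (1 - y) J" "isinv (1 + y) J'"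
  shows "isinv (1 - y * y) ((1/2) *\<^sub>R (J + J'))"
proof -
  have J: "(1 - y) * J = 1" "J * (1 - y) = 1" "(1 + y) * J' = 1" "J' * (1 + y) = 1"
    using assms by (auto simp: isinv_def)
  have f: "1 - y * y = (1 + y) * (1 - y)" "1 - y * y = (1 - y) * (1 + y)"
    by (simp_all add: algebra_simps)
  have "(1 - y * y) * J = 1 + y" "J * (1 - y * y) = 1 + y"
    "(1 - y * y) * J' = 1 - y" "J' * (1 - y * y) = 1 - y"
    using J f by (metis mult.assoc mult_1 mult_1_right)+
  moreover have "(1/2) *\<^sub>R (2::'a) = (1/2) *\<^sub>R (2 *\<^sub>R 1)"
    by (simp only: scaleR_2 one_add_one)
  ultimately show ?thesis
    by (simp add: isinv_def distrib_left distrib_right)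
qed

text \<open>The difference \<open>u' - v' = u' * (v - u) * v'\<close> has at most half the norm of
  \<open>v'\<close>, which can be absorbed: the inverses of invertible elements near
  \<open>u\<close> stay bounded.\<close>

lemma norm_isinv_perturb:
  fixes u v :: "'a::real_normed_algebra_1"
  assumes "isinv u u'" "isinv v v'" "norm (v - u) * norm u' \<le> 1/2"
  shows "norm v' \<le> 2 * norm u'"
proof -
  have "norm (u' - v') \<le> norm u' * norm (v - u) * norm v'"
    unfolding inverse_diff_eq[OF assms(1,2)]
    by (meson norm_mult_ineq mult_right_mono norm_ge_zero order_trans)
  also have "\<dots> \<le> 1/2 * norm v'"
    using assms(3) by (intro mult_right_mono) (auto simp: mult.commute)
  finally show ?thesis
    using norm_triangle_ineq3[of u' v'] by linarith
qed

text \<open>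
  Rickart's proof of the spectral radius formula.  The resolvents at the points \<open>\<omega>\<close> and \<open>r \<omega>\<close>
  stay uniformly close when \<open>x\<close> is replaced by \<open>x\<^sup>2\<close> and \<open>r\<close> by \<open>r\<^sup>2\<close>, because
  \<open>2 (1 - y\<^sup>2)\<^sup>-\<^sup>1 = (1 - y)\<^sup>-\<^sup>1 + (1 + y)\<^sup>-\<^sup>1\<close>.
\<close>

lemma not_all_invble_on_circle:
  fixes x :: "'a::unital_cstar_algebra"
  assumes "adj x = x" "norm x = 1" and inv: "\<And>\<omega>. cmod \<omega> = 1 \<Longrightarrow> invble (1 - \<omega> *\<^sub>C x)"
  shows False
proof -
  define R where "R \<omega> = (SOME b. isinv (1 - \<omega> *\<^sub>C x) b)" for \<omega>
  have R: "isinv (1 - \<omega> *\<^sub>C x) (R \<omega>)" if "cmod \<omega> = 1" for \<omega>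
    using inv[OF that] unfolding R_def invble_def by (rule someI_ex)
  \<comment> \<open>Compactness of the circle: points with ever larger resolvents would accumulate
    at some \<open>\<omega>\<close>, near which the perturbation bound
    \<open>2 * norm (R \<omega>)\<close> holds.\<close>
  have "\<exists>M. \<forall>\<omega>. cmod \<omega> = 1 \<longrightarrow> norm (R \<omega>) \<le> M"
  proof (rule ccontr)
    assume "\<not> ?thesis"
    then have "\<forall>n::nat. \<exists>\<omega>. cmod \<omega> = 1 \<and> norm (R \<omega>) > real n"
      by (meson not_less)
    then obtain w where w: "\<And>n. cmod (w n) = 1" "\<And>n::nat. norm (R (w n)) > real n"
      by metis
    obtain \<omega> s where s: "\<omega> \<in> sphere 0 1" "strict_mono (s :: nat \<Rightarrow> nat)" "(w \<circ> s) \<longlonglongrightarrow> \<omega>"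
      using compact_sphere[of "0::complex" 1] w(1) unfolding compact_def by (metis dist_0_norm mem_sphere)
    have \<omega>: "cmod \<omega> = 1"
      using s(1) by simp
    have "(\<lambda>n. cmod ((w \<circ> s) n - \<omega>) * norm (R \<omega>)) \<longlonglongrightarrow> 0 * norm (R \<omega>)"
      using s(3) by (intro tendsto_mult tendsto_const tendsto_norm_zero LIM_zero)
    then have "\<forall>\<^sub>F n in sequentially. cmod ((w \<circ> s) n - \<omega>) * norm (R \<omega>) < 1/2"
      by (rule order_tendstoD) simp
    moreover have "\<forall>\<^sub>F n in sequentially. real n > 2 * norm (R \<omega>)"
      by (rule eventually_gt_at_top[THEN eventually_compose_filterlim]) (rule filterlim_real_sequentially)
    ultimately have "\<forall>\<^sub>F n in sequentially. cmod ((w \<circ> s) n - \<omega>) * norm (R \<omega>) < 1/2 \<and> real n > 2 * norm (R \<omega>)"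
      by (rule eventually_conj)
    then obtain n where n: "cmod (w (s n) - \<omega>) * norm (R \<omega>) < 1/2" "real n > 2 * norm (R \<omega>)"
      by (auto simp: eventually_sequentially)
    have "norm ((1 - w (s n) *\<^sub>C x) - (1 - \<omega> *\<^sub>C x)) = cmod (w (s n) - \<omega>)"
      by (simp add: norm_minus_commute norm_scaleC assms flip: scaleC_diff_left)
    then have "norm (R (w (s n))) \<le> 2 * norm (R \<omega>)"
      using n by (intro norm_isinv_perturb[OF R[OF \<omega>] R[OF w(1)]]) auto
    moreover have "n \<le> s n"
      using s(2) by (rule seq_suble)
    ultimately show False
      using w(2)[of "s n"] n(2) by linarith
  qed
  then obtain M0 where M0: "\<And>\<omega>. cmod \<omega> = 1 \<Longrightarrow> norm (R \<omega>) \<le> M0"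
    by blast
  define M where "M = max M0 1"
  have M: "M \<ge> 1" "\<And>\<omega>. cmod \<omega> = 1 \<Longrightarrow> norm (R \<omega>) \<le> M"
    using M0 by (auto simp: M_def le_max_iff_disj)
  \<comment> \<open>The gap \<open>1 - r\<close> is fixed by the initial closeness
    \<open>(1 - r) * M * (2 * M) = 1/8\<close>, where \<open>2 * M\<close> will bound the resolvent
    at radius \<open>r\<close>.\<close>
  define r where "r = 1 - 1 / (16 * M\<^sup>2)"
  have M2: "1 \<le> M\<^sup>2"
    using M(1) by simp
  have r: "0 \<le> r" "r < 1" "(1 - r) * M * (2 * M) = 1/8"
    using M2 by (auto simp: r_def field_simps power2_eq_square)
  have r2: "(1 - r) * M \<le> 1/2"
    using M(1) M2 by (simp add: r_def field_simps power2_eq_square)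
  have D: "cmod \<omega> = 1 \<Longrightarrow> \<exists>J K. isinv (1 - \<omega> *\<^sub>C x ^ 2 ^ m) J \<and>
      isinv (1 - (\<omega> * complex_of_real (r ^ 2 ^ m)) *\<^sub>C x ^ 2 ^ m) K \<and> norm (J - K) \<le> 1/8" for m \<omega>
  proof (induction m arbitrary: \<omega>)
    case 0
    have "norm ((\<omega> * complex_of_real r) *\<^sub>C x) < 1"
      using r 0 by (simp add: norm_scaleC norm_mult assms)
    then obtain K where K: "isinv (1 - (\<omega> * complex_of_real r) *\<^sub>C x) K"
      using invble_one_minus unfolding invble_def by blast
    have eq: "norm ((1 - (\<omega> * complex_of_real r) *\<^sub>C x) - (1 - \<omega> *\<^sub>C x)) = 1 - r"
    proof -
      have "(1 - (\<omega> * complex_of_real r) *\<^sub>C x) - (1 - \<omega> *\<^sub>C x) = (\<omega> * complex_of_real (1 - r)) *\<^sub>C x"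
        by (simp add: algebra_simps scaleC_diff_left)
      also have "norm \<dots> = 1 - r"
        using r 0 assms(2) by (simp only: norm_scaleC norm_mult norm_of_real) simp
      finally show ?thesis .
    qed
    have "(1 - r) * norm (R \<omega>) \<le> 1/2"
      using r2 M(2)[OF 0] r(2) by (meson diff_ge_0_iff_ge less_imp_le mult_left_mono order_trans)
    then have "norm K \<le> 2 * norm (R \<omega>)"
      using eq by (intro norm_isinv_perturb[OF R[OF 0] K]) auto
    then have K2: "norm K \<le> 2 * M"
      using M(2)[OF 0] by linarith
    have "norm (R \<omega> - K) \<le> norm (R \<omega>) * (1 - r) * norm K"
      unfolding inverse_diff_eq[OF R[OF 0] K] eq[symmetric]
      by (meson norm_mult_ineq mult_right_mono norm_ge_zero order_trans)
    also have "\<dots> \<le> M * (1 - r) * (2 * M)"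
      using M r K2 M(2)[OF 0] by (intro mult_mono) auto
    also have "\<dots> = 1/8"
      using r(3) by (simp add: mult_ac)
    finally show ?case
      using R[OF 0] K by auto
  next
    case (Suc m)
    \<comment> \<open>Both square roots \<open>\<nu>\<close> and \<open>- \<nu>\<close> lie on the
      circle. The resolvents there average to the one of the squared element at
      \<open>\<omega>\<close>, and averaging does not enlarge the bound \<open>1/8\<close>.\<close>
    define \<nu> where "\<nu> = csqrt \<omega>"
    have \<nu>: "\<nu> * \<nu> = \<omega>" "cmod \<nu> = 1" "cmod (- \<nu>) = 1"
      using Suc.prems power2_csqrt[of \<omega>] by (simp_all add: \<nu>_def power2_eq_square)
    obtain J K where 1: "isinv (1 - \<nu> *\<^sub>C x ^ 2 ^ m) J"
       "isinv (1 - (\<nu> * complex_of_real (r ^ 2 ^ m)) *\<^sub>C x ^ 2 ^ m) K" "norm (J - K) \<le> 1/8"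
      using Suc.IH[OF \<nu>(2)] by blast
    obtain J' K' where 2: "isinv (1 + \<nu> *\<^sub>C x ^ 2 ^ m) J'"
       "isinv (1 + (\<nu> * complex_of_real (r ^ 2 ^ m)) *\<^sub>C x ^ 2 ^ m) K'" "norm (J' - K') \<le> 1/8"
      using Suc.IH[OF \<nu>(3)] by (auto simp: scaleC_minus_left)
    have p: "x ^ 2 ^ Suc m = x ^ 2 ^ m * x ^ 2 ^ m" "r ^ 2 ^ Suc m = r ^ 2 ^ m * r ^ 2 ^ m"
      by (simp_all add: mult_2 power_add)
    have "isinv (1 - \<omega> *\<^sub>C x ^ 2 ^ Suc m) ((1/2) *\<^sub>R (J + J'))"
      using isinv_one_minus_square[OF 1(1) 2(1)] \<nu>(1)
      by (simp add: p mult_scaleC_left mult_scaleC_right scaleC_scaleC del: power_Suc)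
    moreover have "isinv (1 - (\<omega> * complex_of_real (r ^ 2 ^ Suc m)) *\<^sub>C x ^ 2 ^ Suc m) ((1/2) *\<^sub>R (K + K'))"
      using isinv_one_minus_square[OF 1(2) 2(2)] unfolding \<nu>(1)[symmetric]
      by (simp add: p mult_scaleC_left mult_scaleC_right scaleC_scaleC mult_ac del: power_Suc)
    moreover have "norm ((1/2) *\<^sub>R (J + J') - (1/2) *\<^sub>R (K + K')) \<le> 1/8"
    proof -
      have "(1/2) *\<^sub>R (J + J') - (1/2) *\<^sub>R (K + K') = (1/2) *\<^sub>R ((J - K) + (J' - K'))"
        by (simp add: algebra_simps)
      then show ?thesis
        using norm_triangle_ineq[of "J - K" "J' - K'"] 1(3) 2(3) by simp
    qed
    ultimately show ?case
      by blast
  qed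
  \<comment> \<open>The value \<open>1/5\<close> gives
    \<open>norm (K - 1) \<le> (1 + norm (K - 1)) / 5\<close>, so at most \<open>1/4\<close>, and
    then \<open>norm (J - 1) \<le> 3/8\<close>. As \<open>- y = (1 - y) * (1 - J)\<close> has norm
    1, \<open>norm (1 - y)\<close> would be at least \<open>8/3\<close>, whereas it is at most
    2.\<close>
  obtain n where n: "r ^ n < 1/5"
    using real_arch_pow_inv[of "1/5" r] r by auto
  have "r ^ 2 ^ n \<le> r ^ n"
    using r by (intro power_decreasing) (auto intro: less_imp_le less_exp)
  with n have rn: "r ^ 2 ^ n < 1/5" "r ^ 2 ^ n \<ge> 0"
    using r by auto
  obtain J K where JK: "isinv (1 - 1 *\<^sub>C x ^ 2 ^ n) J"
      "isinv (1 - (1 * complex_of_real (r ^ 2 ^ n)) *\<^sub>C x ^ 2 ^ n) K" "norm (J - K) \<le> 1/8"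
    using D[of 1 n] by (metis norm_one)
  define y where "y = x ^ 2 ^ n"
  have y: "norm y = 1"
    using norm_power_selfadj[OF assms(1), of n] assms(2) by (simp add: y_def)
  have J: "isinv (1 - y) J" and K: "isinv (1 - r ^ 2 ^ n *\<^sub>R y) K"
    using JK by (simp_all add: y_def scaleC_one scaleR_scaleC)
  have e: "K - 1 = (r ^ 2 ^ n *\<^sub>R y) * K"
    using K by (simp add: isinv_def algebra_simps)
  then have k: "norm (K - 1) \<le> r ^ 2 ^ n * norm K"
    using norm_mult_ineq[of "r ^ 2 ^ n *\<^sub>R y" K] y rn(2) by simp
  have "norm (K - 1) \<le> 1/5 * norm K"
    using k rn by (meson less_imp_le mult_right_mono norm_ge_zero order_trans)
  moreover have "norm K \<le> 1 + norm (K - 1)"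
    using norm_triangle_ineq[of 1 "K - 1"] by simp
  ultimately have "norm (K - 1) \<le> 1/4"
    by linarith
  then have j: "norm (J - 1) \<le> 3/8"
    using norm_triangle_ineq[of "J - K" "K - 1"] JK(3) by simp
  have "- y = (1 - y) * (1 - J)"
    using J by (simp add: isinv_def algebra_simps)
  then have "norm y \<le> norm (1 - y) * norm (1 - J)"
    by (metis norm_minus_cancel norm_mult_ineq)
  also have "\<dots> \<le> norm (1 - y) * (3/8)"
    using j by (intro mult_left_mono) (auto simp: norm_minus_commute)
  finally have "8/3 \<le> norm (1 - y)"
    using y by simp
  then show False
    using norm_triangle_ineq4[of 1 y] y by simp
qed

text \<open>Only real scalars are tested and 0 is not adjoined, unlike in \<open>spectrum\<close>.
  For self-adjoint \<open>a\<close> there are no other spectral values, by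
  \<open>invble_add_imaginary\<close>.\<close>

definition rspec :: "'a::unital_cstar_algebra \<Rightarrow> real set" where
  "rspec a = {t. \<not> invble (t *\<^sub>R 1 - a)}"

lemma rspec_bound: "t \<in> rspec a \<Longrightarrow> \<bar>t\<bar> \<le> norm a"
  using invble_scalar_minus[of a "complex_of_real t"]
  by (force simp: rspec_def scaleR_scaleC not_less[symmetric])

text \<open>After scaling to norm 1, the nonreal points of the unit circle are harmless by Arens'
  trick. If both real points were harmless too, the whole circle would be, contradicting
  \<open>not_all_invble_on_circle\<close>.\<close>

lemma norm_in_rspec:
  fixes a :: "'a::unital_cstar_algebra"
  assumes "adj a = a"
  shows "norm a \<in> rspec a \<or> - norm a \<in> rspec a"
proof (cases "a = 0")
  case True
  then show ?thesis
    by (simp add: rspec_def invble_def isinv_def)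
next
  case False
  show ?thesis
  proof (rule ccontr)
    assume n: "\<not> ?thesis"
    define x where "x = (1 / norm a) *\<^sub>R a"
    have x: "adj x = x" "norm x = 1"
      using assms False by (simp_all add: x_def adj_scaleR)
    have "norm a *\<^sub>R (1 - x) = norm a *\<^sub>R 1 - a" "(- norm a) *\<^sub>R (1 + x) = (- norm a) *\<^sub>R 1 - a"
      using False by (simp_all add: x_def scaleR_diff_right scaleR_add_right)
    then have i: "invble (norm a *\<^sub>R (1 - x))" "invble ((- norm a) *\<^sub>R (1 + x))"
      using n by (simp_all only: rspec_def mem_Collect_eq de_Morgan_disj not_not)
    have "invble ((1 / norm a) *\<^sub>R (norm a *\<^sub>R (1 - x)))" "invble ((- 1 / norm a) *\<^sub>R ((- norm a) *\<^sub>R (1 + x)))"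
      using False by (intro invble_scaleR i; simp)+
    then have i2: "invble (1 - x)" "invble (1 + x)"
      using False by (simp_all add: add.commute)
    have "invble (1 - \<omega> *\<^sub>C x)" if \<omega>: "cmod \<omega> = 1" for \<omega>
    proof (cases "Im \<omega> = 0")
      case True
      then have "\<omega> = 1 \<or> \<omega> = -1"
        using \<omega> by (auto simp: complex_eq_iff cmod_eq_Re)
      then show ?thesis
        using i2 by (auto simp: scaleC_one scaleC_minus_one)
    next
      case False
      \<comment> \<open>Since \<open>\<omega>\<close> has modulus 1,
        \<open>1 - \<omega> x = \<omega> (cnj \<omega> - x)\<close>, and \<open>cnj \<omega>\<close>
        is a nonreal scalar.\<close>
      have \<omega>0: "\<omega> \<noteq> 0"
        using \<omega> by auto
      have "invble ((Re \<omega> *\<^sub>R 1 - x) + (\<i> * complex_of_real (- Im \<omega>)) *\<^sub>C 1)"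
        using False x by (intro invble_add_imaginary) (auto simp: adj_diff adj_scaleR)
      moreover have "(Re \<omega> *\<^sub>R 1 - x) + (\<i> * complex_of_real (- Im \<omega>)) *\<^sub>C 1 = cnj \<omega> *\<^sub>C 1 - x"
      proof -
        have "cnj \<omega> = complex_of_real (Re \<omega>) + \<i> * complex_of_real (- Im \<omega>)"
          by (simp add: complex_eq_iff)
        then have "cnj \<omega> *\<^sub>C (1::'a) = Re \<omega> *\<^sub>R 1 + (\<i> * complex_of_real (- Im \<omega>)) *\<^sub>C 1"
          by (simp only: scaleC_add_left scaleR_scaleC)
        then show ?thesis
          by (simp only: diff_add_eq)
      qed
      ultimately have "invble (cnj \<omega> *\<^sub>C 1 - x)"
        by (simp only:)
      with \<omega>0 have "invble (\<omega> *\<^sub>C (cnj \<omega> *\<^sub>C 1 - x))"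
        by (rule invble_scaleC)
      moreover have "\<omega> * cnj \<omega> = 1"
        using \<omega> by (simp add: complex_norm_square[symmetric])
      ultimately show ?thesis
        by (simp add: scaleC_diff_right scaleC_scaleC scaleC_one)
    qed
    with not_all_invble_on_circle[OF x] show False
      by blast
  qed
qed

lemma rspec_nonempty: "adj a = a \<Longrightarrow> rspec a \<noteq> {}"
  using norm_in_rspec by fastforce

section \<open>Real polynomials of an element\<close>

text \<open>Horner evaluation in any real unital algebra: it is needed at elements of the C*-algebra
  and also at complex numbers, where roots of real polynomials are found.\<close>

definition rpoly :: "real poly \<Rightarrow> 'a::real_algebra_1 \<Rightarrow> 'a" where
  "rpoly p a = fold_coeffs (\<lambda>c b. c *\<^sub>R 1 + a * b) p 0"

lemma rpoly_0 [simp]: "rpoly 0 a = 0"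
  by (simp add: rpoly_def)

lemma rpoly_pCons [simp]: "rpoly (pCons c p) a = c *\<^sub>R 1 + a * rpoly p a"
  by (cases "p = 0 \<and> c = 0") (auto simp: rpoly_def)

lemma rpoly_add: "rpoly (p + q) a = rpoly p a + rpoly q a"
  by (induction p q rule: poly_induct2) (simp_all add: algebra_simps)

lemma rpoly_smult: "rpoly (smult c p) a = c *\<^sub>R rpoly p a"
  by (induction p) (simp_all add: scaleR_add_right)

lemma rpoly_diff: "rpoly (p - q) a = rpoly p a - rpoly q a"
  using rpoly_add[of p "smult (-1) q" a] unfolding rpoly_smult by simp

lemma rpoly_mult: "rpoly (p * q) a = rpoly p a * rpoly q a"
  by (induction p) (simp_all add: rpoly_add rpoly_smult algebra_simps)

lemma rpoly_pcompose: "rpoly (pcompose p q) a = rpoly p (rpoly q a)"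
  by (induction p) (simp_all add: pcompose_pCons rpoly_add rpoly_mult)

lemma rpoly_commute: "a * rpoly p a = rpoly p a * a"
  using rpoly_mult[of "[:0, 1:]" p a] rpoly_mult[of p "[:0, 1:]" a] by (simp add: mult.commute)

lemma adj_rpoly:
  fixes a :: "'a::unital_cstar_algebra"
  assumes "adj a = a"
  shows "adj (rpoly p a) = rpoly p a"
  by (induction p) (simp_all add: adj_add adj_mult adj_scaleR assms rpoly_commute)

lemma rpoly_complex_root:
  assumes "degree p > 0"
  shows "\<exists>z::complex. rpoly p z = 0"
proof -
  have eq: "rpoly p z = poly (map_poly complex_of_real p) z" for z
    by (induction p) (simp_all add: map_poly_pCons scaleR_conv_of_real)
  have "\<not> constant (poly (map_poly complex_of_real p))"
    using assms by (simp add: constant_degree degree_map_poly)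
  from fundamental_theorem_of_algebra[OF this] show ?thesis
    by (simp add: eq)
qed

lemma rpoly_real: "rpoly p (complex_of_real t) = complex_of_real (poly p t)"
  by (induction p) (simp_all add: scaleR_conv_of_real)

text \<open>The quadratic is \<open>(X - z) (X - cnj z)\<close>. The remainder of \<open>p\<close>
  is real of degree at most 1, and such a polynomial vanishes at a nonreal point only if it is
  zero.\<close>

lemma quadratic_dvd:
  assumes "rpoly p z = 0" "Im z \<noteq> 0"
  shows "[:(cmod z)\<^sup>2, - 2 * Re z, 1:] dvd p"
proof -
  let ?Q = "[:(cmod z)\<^sup>2, - 2 * Re z, 1:]"
  have "rpoly ?Q z = 0"
    by (simp add: complex_eq_iff cmod_power2 algebra_simps)
       (simp add: power2_eq_square)
  then have "rpoly (p - ?Q * (p div ?Q)) z = 0"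
    by (simp only: assms(1) rpoly_diff rpoly_mult mult_zero_left diff_self)
  then have r: "rpoly (p mod ?Q) z = 0"
    by (simp only: minus_mult_div_eq_mod)
  have "degree (p mod ?Q) \<le> 1"
    using degree_mod_less[of ?Q p] by (auto split: if_splits)
  moreover obtain r0 s where rs: "p mod ?Q = pCons r0 s"
    by (rule pCons_cases)
  ultimately have "degree s = 0"
    by (cases "s = 0") auto
  then obtain r1 where "p mod ?Q = [:r0, r1:]"
    using rs degree_eq_zeroE by metis
  with r assms(2) have "p mod ?Q = 0"
    by (auto simp: complex_eq_iff)
  then show ?thesis
    by (simp add: dvd_eq_mod_eq_0)
qed

text \<open>Factors are split off along complex roots. A real root lies outside
  \<open>rspec a\<close> by assumption; a nonreal root contributes, after completing the square,
  \<open>(a - Re z)\<^sup>2 + (Im z)\<^sup>2\<close>, which is invertible.\<close>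

lemma invble_rpoly:
  fixes a :: "'a::unital_cstar_algebra"
  assumes "adj a = a" "q \<noteq> 0" "\<And>t. t \<in> rspec a \<Longrightarrow> poly q t \<noteq> 0"
  shows "invble (rpoly q a)"
  using assms(2,3)
proof (induction "degree q" arbitrary: q rule: less_induct)
  case less
  show ?case
  proof (cases "degree q = 0")
    case True
    then obtain c where "q = [:c:]"
      by (rule degree_eq_zeroE)
    then show ?thesis
      using less.prems(1) by (simp add: invble_scaleR)
  next
    case False
    then obtain z where z: "rpoly q z = (0::complex)"
      using rpoly_complex_root by blast
    have "\<exists>d. d dvd q \<and> degree d > 0 \<and> invble (rpoly d a)"
    proof (cases "Im z = 0")
      case True
      then have zr: "z = complex_of_real (Re z)"
        by (simp add: complex_eq_iff)
      then have "poly q (Re z) = 0"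
        using z rpoly_real[of q "Re z"] by simp
      then have "Re z \<notin> rspec a" "[:- Re z, 1:] dvd q"
        using less.prems(2) poly_eq_0_iff_dvd by blast+
      moreover from this have "invble (rpoly [:- Re z, 1:] a)"
        using invble_minus[of "Re z *\<^sub>R 1 - a"] by (simp add: rspec_def)
      ultimately show ?thesis
        by (intro exI[of _ "[:- Re z, 1:]"]) auto
    next
      case False
      let ?c = "a - Re z *\<^sub>R 1"
      have "rpoly [:(cmod z)\<^sup>2, - 2 * Re z, 1:] a = ?c * ?c + (Im z)\<^sup>2 *\<^sub>R 1"
        by (simp add: cmod_power2 algebra_simps)
           (simp add: power2_eq_square scaleR_add_left[symmetric])
      also have "invble \<dots>"
        using False assms(1) by (intro invble_square_add) (auto simp: adj_diff adj_scaleR)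
      finally show ?thesis
        using quadratic_dvd[OF z False] by (intro exI[of _ "[:(cmod z)\<^sup>2, - 2 * Re z, 1:]"]) auto
    qed
    then obtain d e where d: "q = d * e" "degree d > 0" "invble (rpoly d a)"
      by (auto simp: dvd_def)
    have "invble (rpoly e a)"
    proof (rule less.hyps)
      show "degree e < degree q"
        using d less.prems(1) by (auto simp: degree_mult_eq)
    qed (use d less.prems in auto)
    with d show ?thesis
      by (simp add: rpoly_mult invble_mult)
  qed
qed

text \<open>This half of spectral mapping suffices for norm bounds. If \<open>p\<close> is the
  constant \<open>s\<close>, then \<open>[:s:] - p\<close> is zero and the factorization says
  nothing; nonemptiness of the spectrum then provides \<open>t\<close>.\<close>

lemma rspec_rpoly:
  fixes a :: "'a::unital_cstar_algebra"
  assumes "adj a = a" "s \<in> rspec (rpoly p a)"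
  shows "\<exists>t\<in>rspec a. poly p t = s"
proof (cases "[:s:] - p = 0")
  case True
  obtain t where "t \<in> rspec a"
    using rspec_nonempty[OF assms(1)] by blast
  moreover have "p = [:s:]"
    using True by simp
  ultimately show ?thesis
    by auto
next
  case False
  have "\<not> invble (rpoly ([:s:] - p) a)"
    using assms(2) by (simp add: rspec_def rpoly_diff)
  then show ?thesis
    using invble_rpoly[OF assms(1) False] by auto
qed

text \<open>The norm of \<open>rpoly p a\<close> is attained in its spectrum, hence by
  \<open>p\<close> on the spectrum of \<open>a\<close>. This estimate extends the calculus from
  polynomials to continuous functions.\<close>

lemma norm_rpoly_le:
  fixes a :: "'a::unital_cstar_algebra"
  assumes "adj a = a" "\<And>t. t \<in> rspec a \<Longrightarrow> \<bar>poly p t\<bar> \<le> c"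
  shows "norm (rpoly p a) \<le> c"
proof -
  obtain s where "s \<in> rspec (rpoly p a)" "\<bar>s\<bar> = norm (rpoly p a)"
    using norm_in_rspec[OF adj_rpoly[OF assms(1), of p]] by auto
  then show ?thesis
    using rspec_rpoly[OF assms(1)] assms(2) by metis
qed

section \<open>Continuous functional calculus\<close>

lemma Weierstrass_poly_seq:
  fixes f :: "real \<Rightarrow> real"
  assumes "continuous_on UNIV f"
  shows "\<exists>p. uniform_limit {-N..N} (\<lambda>n. poly (p n)) f sequentially"
proof -
  have "\<exists>p. \<forall>t\<in>{-N..N}. \<bar>f t - poly p t\<bar> < inverse (Suc n)" for n
  proof -
    obtain g where g: "real_polynomial_function g" "\<And>x. x \<in> {-N..N} \<Longrightarrow> \<bar>f x - g x\<bar> < inverse (Suc n)"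
      by (rule Stone_Weierstrass_real_polynomial_function[of "{-N..N}" f "inverse (Suc n)"])
         (use continuous_on_subset[OF assms] in auto)
    obtain b m where "g = (\<lambda>x. \<Sum>i\<le>m. b i * x ^ i)"
      using g(1) unfolding real_polynomial_function_iff_sum by blast
    then have "g = poly (\<Sum>i\<le>m. monom (b i) i)"
      by (simp add: poly_sum poly_monom fun_eq_iff)
    with g(2) show ?thesis
      by blast
  qed
  then obtain p where p: "\<And>n t. t \<in> {-N..N} \<Longrightarrow> \<bar>f t - poly (p n) t\<bar> < inverse (Suc n)"
    by metis
  have "uniform_limit {-N..N} (\<lambda>n. poly (p n)) f sequentially"
  proof (rule uniform_limitI)
    fix e :: real assume "e > 0"
    then have "\<forall>\<^sub>F n in sequentially. inverse (real (Suc n)) < e"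
      by (rule order_tendstoD(2)[OF LIMSEQ_inverse_real_of_nat])
    then show "\<forall>\<^sub>F n in sequentially. \<forall>x\<in>{-N..N}. dist (poly (p n) x) (f x) < e"
    proof (rule eventually_mono)
      fix n assume n: "inverse (real (Suc n)) < e"
      show "\<forall>x\<in>{-N..N}. dist (poly (p n) x) (f x) < e"
      proof
        fix x assume "x \<in> {-N..N}"
        from p[OF this, of n] n show "dist (poly (p n) x) (f x) < e"
          unfolding dist_real_def by linarith
      qed
    qed
  qed
  then show ?thesis
    by blast
qed

text \<open>The constant terms tend to \<open>f 0 = 0\<close>, so subtracting them keeps uniform
  convergence. The form \<open>pCons 0\<close> exposes a factor \<open>a\<close> on evaluation,
  which keeps the value in every subalgebra containing \<open>a\<close>.\<close>

lemma Weierstrass_poly_seq_0: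
  fixes f :: "real \<Rightarrow> real"
  assumes "continuous_on UNIV f" "f 0 = 0" "N \<ge> 0"
  shows "\<exists>p. uniform_limit {-N..N} (\<lambda>n. poly (pCons 0 (p n))) f sequentially"
proof -
  obtain p where p: "uniform_limit {-N..N} (\<lambda>n. poly (p n)) f sequentially"
    using Weierstrass_poly_seq[OF assms(1)] by blast
  have "(\<lambda>n. poly (p n) 0) \<longlonglongrightarrow> f 0"
    by (rule tendsto_uniform_limitI[OF p]) (use assms(3) in auto)
  then have "uniform_limit {-N..N} (\<lambda>n t. poly (p n) 0) (\<lambda>t. 0) sequentially"
    using assms(2) by (simp add: uniform_limit_iff tendsto_iff)
  from uniform_limit_minus[OF p this]
  have u: "uniform_limit {-N..N} (\<lambda>n t. poly (p n) t - poly (p n) 0) f sequentially"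
    by simp
  define q where "q n = synthetic_div (p n) 0" for n
  have q: "poly (p n) t - poly (p n) 0 = poly (pCons 0 (q n)) t" for n t
    using arg_cong[OF synthetic_div_correct'[of 0 "p n"], of "\<lambda>r. poly r t"] by (simp add: q_def)
  show ?thesis
    by (rule exI[of _ q]) (rule u[unfolded q])
qed

text \<open>Uniformly Cauchy polynomials have Cauchy values at \<open>a\<close> by
  \<open>norm_rpoly_le\<close>. The same estimate compares an arbitrary \<open>p\<close> with the
  approximants, so the limit obeys the error bound for all polynomials.\<close>

lemma rpoly_limit_exists:
  fixes a :: "'a::unital_cstar_algebra" and f :: "real \<Rightarrow> real"
  assumes a: "adj a = a" and f: "continuous_on UNIV f"
  shows "\<exists>b. \<forall>p e. (\<forall>t\<in>rspec a. \<bar>poly p t - f t\<bar> \<le> e) \<longrightarrow> norm (rpoly p a - b) \<le> e"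
proof -
  obtain q where q: "uniform_limit {- norm a..norm a} (\<lambda>n. poly (q n)) f sequentially"
    using Weierstrass_poly_seq[OF f] by blast
  have sub: "t \<in> {- norm a..norm a}" if "t \<in> rspec a" for t
    using rspec_bound[OF that] by auto
  have ev: "\<forall>\<^sub>F n in sequentially. \<forall>t\<in>rspec a. \<bar>poly (q n) t - f t\<bar> < e" if "e > 0" for e
    using uniform_limitD[OF q that] by (rule eventually_mono) (use sub in \<open>auto simp: dist_real_def\<close>)
  have "Cauchy (\<lambda>n. rpoly (q n) a)"
  proof (rule CauchyI)
    fix e :: real assume "e > 0"
    then obtain M where M: "\<And>n t. n \<ge> M \<Longrightarrow> t \<in> rspec a \<Longrightarrow> \<bar>poly (q n) t - f t\<bar> < e / 3"
      using ev[of "e / 3"] by (auto simp: eventually_sequentially)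
    have "norm (rpoly (q m) a - rpoly (q n) a) < e" if "m \<ge> M" "n \<ge> M" for m n
    proof -
      have "norm (rpoly (q m - q n) a) \<le> 2 * (e / 3)"
      proof (rule norm_rpoly_le[OF a])
        fix t assume "t \<in> rspec a"
        from M[OF that(1) this] M[OF that(2) this]
        show "\<bar>poly (q m - q n) t\<bar> \<le> 2 * (e / 3)"
          unfolding poly_diff by linarith
      qed
      then show ?thesis
        using \<open>e > 0\<close> by (simp add: rpoly_diff)
    qed
    then show "\<exists>M. \<forall>m\<ge>M. \<forall>n\<ge>M. norm (rpoly (q m) a - rpoly (q n) a) < e"
      by blast
  qed
  then obtain b where b: "(\<lambda>n. rpoly (q n) a) \<longlonglongrightarrow> b"
    using Cauchy_convergent convergent_def by blast
  have "norm (rpoly p a - b) \<le> e" if p: "\<forall>t\<in>rspec a. \<bar>poly p t - f t\<bar> \<le> e" for p e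
  proof (rule field_le_epsilon)
    fix d :: real assume d: "d > 0"
    have "\<forall>\<^sub>F n in sequentially. norm (rpoly p a - rpoly (q n) a) \<le> e + d"
      using ev[OF d]
    proof (rule eventually_mono)
      fix n assume n: "\<forall>t\<in>rspec a. \<bar>poly (q n) t - f t\<bar> < d"
      have "norm (rpoly (p - q n) a) \<le> e + d"
      proof (rule norm_rpoly_le[OF a])
        fix t assume "t \<in> rspec a"
        then have "\<bar>poly (q n) t - f t\<bar> < d" "\<bar>poly p t - f t\<bar> \<le> e"
          using n p by auto
        then show "\<bar>poly (p - q n) t\<bar> \<le> e + d"
          unfolding poly_diff by linarith
      qed
      then show "norm (rpoly p a - rpoly (q n) a) \<le> e + d"
        by (simp add: rpoly_diff)
    qed
    then show "norm (rpoly p a - b) \<le> e + d"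
      by (intro tendsto_upperbound[of "\<lambda>n. norm (rpoly p a - rpoly (q n) a)"]) (auto intro!: tendsto_intros b)
  qed
  then show ?thesis
    by blast
qed

text \<open>The value is fixed by an error bound over all polynomials, so that no particular
  approximating sequence enters and every one converges to it.\<close>

definition fcalc :: "(real \<Rightarrow> real) \<Rightarrow> 'a::unital_cstar_algebra \<Rightarrow> 'a" where
  "fcalc f a = (SOME b. \<forall>p e. (\<forall>t\<in>rspec a. \<bar>poly p t - f t\<bar> \<le> e) \<longrightarrow> norm (rpoly p a - b) \<le> e)"

lemma fcalc_approx:
  assumes "adj a = a" "continuous_on UNIV f" "\<And>t. t \<in> rspec a \<Longrightarrow> \<bar>poly p t - f t\<bar> \<le> e"
  shows "norm (rpoly p a - fcalc f a) \<le> e"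
  using someI_ex[OF rpoly_limit_exists[OF assms(1,2)]] assms(3) unfolding fcalc_def by blast

lemma fcalc_tendsto:
  assumes "adj a = a" "continuous_on UNIV f" "uniform_limit (rspec a) (\<lambda>n. poly (p n)) f sequentially"
  shows "(\<lambda>n. rpoly (p n) a) \<longlonglongrightarrow> fcalc f a"
proof (rule tendstoI)
  fix e :: real assume e: "e > 0"
  from uniform_limitD[OF assms(3), of "e / 2"] e
  have "\<forall>\<^sub>F n in sequentially. \<forall>t\<in>rspec a. dist (poly (p n) t) (f t) < e / 2"
    by simp
  then show "\<forall>\<^sub>F n in sequentially. dist (rpoly (p n) a) (fcalc f a) < e"
  proof (rule eventually_mono)
    fix n assume "\<forall>t\<in>rspec a. dist (poly (p n) t) (f t) < e / 2"
    then have "norm (rpoly (p n) a - fcalc f a) \<le> e / 2"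
      by (intro fcalc_approx assms(1,2)) (auto simp: dist_real_def intro: less_imp_le)
    with e show "dist (rpoly (p n) a) (fcalc f a) < e"
      by (simp add: dist_norm)
  qed
qed

lemma rspec_subset: "norm a \<le> N \<Longrightarrow> rspec a \<subseteq> {-N..N}"
  using rspec_bound by fastforce

lemma rspec_poly_seq:
  fixes f :: "real \<Rightarrow> real"
  assumes "continuous_on UNIV f"
  obtains p where "uniform_limit (rspec a) (\<lambda>n. poly (p n)) f sequentially"
  using Weierstrass_poly_seq[OF assms, of "norm a"] rspec_subset[of a "norm a"] uniform_limit_on_subset
  by blast

text \<open>Uniform convergence of products requires bounded limits; the compact interval around the
  spectrum provides the bound.\<close>

lemma bounded_image_rspec:
  fixes f :: "real \<Rightarrow> real"
  assumes "continuous_on UNIV f"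
  shows "bounded (f ` rspec a)"
proof (rule bounded_subset)
  show "bounded (f ` {- norm a..norm a})"
    by (intro compact_imp_bounded compact_continuous_image) (use assms continuous_on_subset in auto)
qed (use rspec_subset[of a "norm a"] in auto)

lemma fcalc_poly:
  assumes "adj a = a"
  shows "fcalc (poly p) a = rpoly p a"
  using fcalc_approx[OF assms, of "poly p" p 0] by (simp add: continuous_intros)

lemma fcalc_cong:
  assumes a: "adj a = a" and "continuous_on UNIV f" "continuous_on UNIV g" "\<And>t. t \<in> rspec a \<Longrightarrow> f t = g t"
  shows "fcalc f a = fcalc g a"
proof -
  obtain p where p: "uniform_limit (rspec a) (\<lambda>n. poly (p n)) f sequentially"
    using rspec_poly_seq[OF assms(2)] .
  then have "uniform_limit (rspec a) (\<lambda>n. poly (p n)) g sequentially"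
    by (simp add: assms(4) cong: uniform_limit_cong')
  with p show ?thesis
    using fcalc_tendsto[OF a] assms(2,3) LIMSEQ_unique by metis
qed

lemma fcalc_add:
  assumes a: "adj a = a" and f: "continuous_on UNIV f" and g: "continuous_on UNIV g"
  shows "fcalc (\<lambda>t. f t + g t) a = fcalc f a + fcalc g a"
proof -
  obtain p q where p: "uniform_limit (rspec a) (\<lambda>n. poly (p n)) f sequentially"
    and q: "uniform_limit (rspec a) (\<lambda>n. poly (q n)) g sequentially"
    using rspec_poly_seq f g by metis
  have "(\<lambda>n. rpoly (p n + q n) a) \<longlonglongrightarrow> fcalc (\<lambda>t. f t + g t) a"
    by (intro fcalc_tendsto a continuous_on_add f g)
       (use uniform_limit_add[OF p q] in \<open>simp add: poly_add[abs_def]\<close>)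
  moreover have "(\<lambda>n. rpoly (p n + q n) a) \<longlonglongrightarrow> fcalc f a + fcalc g a"
    unfolding rpoly_add by (intro tendsto_add fcalc_tendsto a f g p q)
  ultimately show ?thesis
    by (rule LIMSEQ_unique)
qed

lemma fcalc_mult:
  assumes a: "adj a = a" and f: "continuous_on UNIV f" and g: "continuous_on UNIV g"
  shows "fcalc (\<lambda>t. f t * g t) a = fcalc f a * fcalc g a"
proof -
  obtain p q where p: "uniform_limit (rspec a) (\<lambda>n. poly (p n)) f sequentially"
    and q: "uniform_limit (rspec a) (\<lambda>n. poly (q n)) g sequentially"
    using rspec_poly_seq f g by metis
  have "(\<lambda>n. rpoly (p n * q n) a) \<longlonglongrightarrow> fcalc (\<lambda>t. f t * g t) a"
    by (intro fcalc_tendsto a continuous_on_mult f g)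
       (use uniform_lim_mult[OF p q bounded_image_rspec[OF f] bounded_image_rspec[OF g]] in
         \<open>simp add: poly_mult[abs_def]\<close>)
  moreover have "(\<lambda>n. rpoly (p n * q n) a) \<longlonglongrightarrow> fcalc f a * fcalc g a"
    unfolding rpoly_mult by (intro tendsto_mult fcalc_tendsto a f g p q)
  ultimately show ?thesis
    by (rule LIMSEQ_unique)
qed

lemma fcalc_const:
  assumes "adj a = a"
  shows "fcalc (\<lambda>t. c) a = c *\<^sub>R 1"
proof -
  have "poly [:c:] = (\<lambda>t::real. c)"
    by (simp add: fun_eq_iff)
  then show ?thesis
    using fcalc_poly[OF assms, of "[:c:]"] by simp
qed

lemma fcalc_id:
  assumes "adj a = a"
  shows "fcalc (\<lambda>t. t) a = a"
proof -
  have "poly [:0, 1:] = (\<lambda>t::real. t)"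
    by (simp add: fun_eq_iff)
  then show ?thesis
    using fcalc_poly[OF assms, of "[:0, 1:]"] by simp
qed

lemma fcalc_scale:
  assumes "adj a = a" "continuous_on UNIV f"
  shows "fcalc (\<lambda>t. c * f t) a = c *\<^sub>R fcalc f a"
  using fcalc_mult[OF assms(1) continuous_on_const assms(2), of c] fcalc_const[OF assms(1), of c] by simp

lemma fcalc_diff:
  assumes a: "adj a = a" and f: "continuous_on UNIV f" and g: "continuous_on UNIV g"
  shows "fcalc (\<lambda>t. f t - g t) a = fcalc f a - fcalc g a"
proof -
  have "continuous_on UNIV (\<lambda>t. (-1) * g t)"
    using g by (intro continuous_intros)
  from fcalc_add[OF a f this] show ?thesis
    using fcalc_scale[OF a g, of "-1"] by simp
qed

lemma norm_fcalc_le: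
  assumes "adj a = a" "continuous_on UNIV f" "\<And>t. t \<in> rspec a \<Longrightarrow> \<bar>f t\<bar> \<le> c"
  shows "norm (fcalc f a) \<le> c"
  using fcalc_approx[OF assms(1,2), of 0 c] assms(3) by simp

lemma adj_fcalc:
  assumes a: "adj a = a" and f: "continuous_on UNIV f"
  shows "adj (fcalc f a) = fcalc f a"
proof -
  obtain p where p: "uniform_limit (rspec a) (\<lambda>n. poly (p n)) f sequentially"
    using rspec_poly_seq[OF f] .
  note t = fcalc_tendsto[OF a f p]
  have "(\<lambda>n. adj (rpoly (p n) a)) \<longlonglongrightarrow> adj (fcalc f a)"
    by (rule bounded_linear.tendsto[OF bounded_linear_adj t])
  then show ?thesis
    using LIMSEQ_unique t by (simp add: adj_rpoly[OF a])
qed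

text \<open>With \<open>q = 1 - X\<close> this turns a function of \<open>1 - g\<close> into a
  function of \<open>g\<close>. For polynomial \<open>f\<close> it is composition of polynomials,
  and the rest is a limit.\<close>

lemma fcalc_rpoly:
  assumes a: "adj a = a" and f: "continuous_on UNIV f"
  shows "fcalc f (rpoly q a) = fcalc (\<lambda>t. f (poly q t)) a"
proof -
  have "bounded (poly q ` rspec a)"
    by (intro bounded_image_rspec continuous_intros)
  then obtain C where C: "\<And>t. t \<in> rspec a \<Longrightarrow> \<bar>poly q t\<bar> \<le> C"
    by (auto simp: bounded_iff)
  \<comment> \<open>The interval has to contain both the spectrum of \<open>rpoly q a\<close> and
    the values of \<open>q\<close> on the spectrum of \<open>a\<close>, so that one sequence serves
    both sides.\<close>
  define N where "N = max (norm (rpoly q a)) C"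
  obtain p where p: "uniform_limit {-N..N} (\<lambda>n. poly (p n)) f sequentially"
    using Weierstrass_poly_seq[OF f] by blast
  have "(\<lambda>n. rpoly (p n) (rpoly q a)) \<longlonglongrightarrow> fcalc f (rpoly q a)"
    by (intro fcalc_tendsto adj_rpoly a f uniform_limit_on_subset[OF p] rspec_subset) (simp add: N_def)
  moreover have "(\<lambda>n. rpoly (pcompose (p n) q) a) \<longlonglongrightarrow> fcalc (\<lambda>t. f (poly q t)) a"
  proof (intro fcalc_tendsto a)
    show "continuous_on UNIV (\<lambda>t. f (poly q t))"
      by (rule continuous_on_compose2[OF f]) (simp_all add: continuous_on_poly continuous_on_id)
    have q: "poly q t \<in> {-N..N}" if "t \<in> rspec a" for t
      using C[OF that] by (auto simp: N_def abs_le_iff)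
    show "uniform_limit (rspec a) (\<lambda>n. poly (pcompose (p n) q)) (\<lambda>t. f (poly q t)) sequentially"
    proof (rule uniform_limitI)
      fix e :: real assume "e > 0"
      from uniform_limitD[OF p this]
      show "\<forall>\<^sub>F n in sequentially. \<forall>t\<in>rspec a. dist (poly (pcompose (p n) q) t) (f (poly q t)) < e"
        by (rule eventually_mono) (use q in \<open>simp add: poly_pcompose\<close>)
    qed
  qed
  ultimately show ?thesis
    unfolding rpoly_pcompose by (rule LIMSEQ_unique)
qed

text \<open>\<open>B\<close> need not contain the unit of the algebra, so the approximants must have
  no constant term; this is where \<open>f 0 = 0\<close> enters.\<close>

lemma fcalc_in_subalgebra:
  assumes a: "adj a = a" and f: "continuous_on UNIV f" "f 0 = 0" and B: "cstar_subalgebra B" "a \<in> B"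
  shows "fcalc f a \<in> B"
proof -
  obtain p where p: "uniform_limit {- norm a..norm a} (\<lambda>n. poly (pCons 0 (p n))) f sequentially"
    using Weierstrass_poly_seq_0[OF f, of "norm a"] by auto
  have t: "(\<lambda>n. rpoly (pCons 0 (p n)) a) \<longlonglongrightarrow> fcalc f a"
    by (intro fcalc_tendsto a f uniform_limit_on_subset[OF p] rspec_subset) simp
  have cl: "x + y \<in> B" "x * y \<in> B" "c *\<^sub>C x \<in> B" "0 \<in> B" if "x \<in> B" "y \<in> B" for x y c
    using B(1) that by (simp_all add: cstar_subalgebra_def)
  \<comment> \<open>The factor \<open>a\<close> is carried through the induction because
    \<open>rpoly r a\<close> alone may lie outside \<open>B\<close>.\<close>
  have "a * rpoly r a \<in> B" for r
  proof (induction r)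
    case 0
    then show ?case
      using cl(4)[OF B(2) B(2)] by simp
  next
    case (pCons c r)
    have "a * rpoly (pCons c r) a = complex_of_real c *\<^sub>C a + a * (a * rpoly r a)"
      by (simp add: distrib_left flip: scaleR_scaleC)
    then show ?case
      using cl(1)[OF cl(3)[OF B(2) B(2)] cl(2)[OF B(2) pCons.IH]] by simp
  qed
  then have m: "rpoly (pCons 0 (p n)) a \<in> B" for n
    by simp
  have "closed B"
    using B by (simp add: cstar_subalgebra_def)
  from closed_sequentially[OF this m t] show ?thesis .
qed

section \<open>Positive elements\<close>

text \<open>Spectral positivity is what the calculus delivers; \<open>positive_iff_nonneg\<close>
  identifies it with the factorized form \<open>positive\<close>.\<close>

definition nonneg :: "'a::unital_cstar_algebra \<Rightarrow> bool" where
  "nonneg a \<longleftrightarrow> adj a = a \<and> (\<forall>t\<in>rspec a. t \<ge> 0)"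

lemma rspec_minus: "t \<in> rspec (- a) \<longleftrightarrow> - t \<in> rspec a"
  using invble_minus[of "t *\<^sub>R 1 + a"] by (simp add: rspec_def)

lemma rspec_scalar_minus: "t \<in> rspec (N *\<^sub>R 1 - a) \<longleftrightarrow> N - t \<in> rspec a"
  using invble_minus[of "(N - t) *\<^sub>R 1 - a"] by (simp add: rspec_def scaleR_diff_left algebra_simps)

text \<open>If \<open>b\<close> inverts \<open>t - y * x\<close>, then
  \<open>(1 + x * b * y) / t\<close> inverts \<open>t - x * y\<close>.\<close>

lemma rspec_mult_commute:
  assumes "t \<in> rspec (x * y)" "t \<noteq> 0"
  shows "t \<in> rspec (y * x)"
proof (rule ccontr)
  assume "t \<notin> rspec (y * x)"
  then obtain b where b: "(t *\<^sub>R 1 - y * x) * b = 1" "b * (t *\<^sub>R 1 - y * x) = 1"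
    by (auto simp: rspec_def invble_def isinv_def)
  have "(t *\<^sub>R 1 - x * y) * (1 + x * b * y) = t *\<^sub>R 1 - x * y + x * ((t *\<^sub>R 1 - y * x) * b) * y"
    "(1 + x * b * y) * (t *\<^sub>R 1 - x * y) = t *\<^sub>R 1 - x * y + x * (b * (t *\<^sub>R 1 - y * x)) * y"
    by (simp_all add: algebra_simps)
  then have "isinv (t *\<^sub>R 1 - x * y) ((1 / t) *\<^sub>R (1 + x * b * y))"
    using b assms(2) by (simp add: isinv_def)
  then show False
    using assms(1) by (auto simp: rspec_def invble_def)
qed

lemma nonneg_square:
  assumes "adj d = d"
  shows "nonneg (d * d)"
  unfolding nonneg_def
proof (intro conjI ballI)
  fix t assume t: "t \<in> rspec (d * d)"
  show "t \<ge> 0"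
  proof (rule ccontr)
    assume "\<not> t \<ge> 0"
    then have "invble (d * d + (sqrt (- t))\<^sup>2 *\<^sub>R 1)"
      by (intro invble_square_add assms) auto
    moreover have "t *\<^sub>R 1 - d * d = - (d * d + (sqrt (- t))\<^sup>2 *\<^sub>R 1)"
      using \<open>\<not> t \<ge> 0\<close> by simp
    ultimately have "invble (t *\<^sub>R 1 - d * d)"
      by (simp only: invble_minus)
    with t show False
      by (simp add: rspec_def)
  qed
qed (simp add: adj_mult assms)

lemma fcalc_square:
  assumes a: "adj a = a" and f: "continuous_on UNIV f" and "\<And>t. t \<in> rspec a \<Longrightarrow> f t \<ge> 0"
  shows "fcalc f a = fcalc (\<lambda>t. sqrt (max 0 (f t))) a * fcalc (\<lambda>t. sqrt (max 0 (f t))) a"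
proof -
  have c: "continuous_on UNIV (\<lambda>t. sqrt (max 0 (f t)))"
    using f by (intro continuous_intros)
  show ?thesis
    unfolding fcalc_mult[OF a c c, symmetric]
    by (rule fcalc_cong[OF a f continuous_on_mult[OF c c]]) (use assms(3) in simp)
qed

lemma nonneg_fcalc:
  assumes a: "adj a = a" and f: "continuous_on UNIV f" and "\<And>t. t \<in> rspec a \<Longrightarrow> f t \<ge> 0"
  shows "nonneg (fcalc f a)"
  by (subst fcalc_square[OF assms], assumption)
     (rule nonneg_square, rule adj_fcalc[OF a], intro continuous_intros f)

text \<open>The spectrum lies in \<open>[- N, N]\<close>, where \<open>t \<ge> 0\<close> means
  \<open>\<bar>N - t\<bar> \<le> N\<close>. In this form positivity passes to sums by the triangle
  inequality.\<close>

lemma nonneg_iff_norm: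
  assumes a: "adj a = a" and N: "norm a \<le> N"
  shows "nonneg a \<longleftrightarrow> norm (N *\<^sub>R 1 - a) \<le> N"
proof
  assume nn: "nonneg a"
  have "norm (rpoly [:N, -1:] a) \<le> N"
  proof (rule norm_rpoly_le[OF a])
    fix t assume t: "t \<in> rspec a"
    then have "0 \<le> t"
      using nn by (simp add: nonneg_def)
    then show "\<bar>poly [:N, -1:] t\<bar> \<le> N"
      using rspec_bound[OF t] N by auto
  qed
  then show "norm (N *\<^sub>R 1 - a) \<le> N"
    by simp
next
  assume n: "norm (N *\<^sub>R 1 - a) \<le> N"
  show "nonneg a"
    unfolding nonneg_def
  proof (intro conjI ballI a)
    fix t assume "t \<in> rspec a"
    then have "N - t \<in> rspec (N *\<^sub>R 1 - a)"
      by (simp add: rspec_scalar_minus)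
    from rspec_bound[OF this] n show "t \<ge> 0"
      by linarith
  qed
qed

lemma nonneg_add:
  assumes "nonneg a" "nonneg b"
  shows "nonneg (a + b)"
proof -
  have ab: "adj a = a" "adj b = b"
    using assms by (auto simp: nonneg_def)
  have "norm ((norm a + norm b) *\<^sub>R 1 - (a + b)) \<le> norm (norm a *\<^sub>R 1 - a) + norm (norm b *\<^sub>R 1 - b)"
    using norm_triangle_ineq[of "norm a *\<^sub>R 1 - a" "norm b *\<^sub>R 1 - b"] by (simp add: algebra_simps)
  also have "\<dots> \<le> norm a + norm b"
    using assms nonneg_iff_norm[OF ab(1)] nonneg_iff_norm[OF ab(2)] by (intro add_mono) auto
  finally show ?thesis
    using nonneg_iff_norm[of "a + b" "norm a + norm b"] ab norm_triangle_ineq by (auto simp: adj_add)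
qed

lemma nonneg_0 [simp]: "nonneg 0"
  using nonneg_square[of 0] by simp

lemma nonneg_scaleR:
  assumes "nonneg a" "c \<ge> 0"
  shows "nonneg (c *\<^sub>R a)"
proof (cases "c = 0")
  case False
  show ?thesis
    unfolding nonneg_def
  proof (intro conjI ballI)
    fix t assume t: "t \<in> rspec (c *\<^sub>R a)"
    have "t / c \<in> rspec a"
    proof (rule ccontr)
      assume "t / c \<notin> rspec a"
      then have "invble (c *\<^sub>R ((t / c) *\<^sub>R 1 - a))"
        using False by (intro invble_scaleR) (auto simp: rspec_def)
      with t False show False
        by (simp add: rspec_def scaleR_diff_right)
    qed
    then have "t / c \<ge> 0"
      using assms by (auto simp: nonneg_def)
    with assms(2) False show "t \<ge> 0"
      by (simp add: zero_le_divide_iff)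
  qed (use assms in \<open>simp add: nonneg_def adj_scaleR\<close>)
qed simp

lemma nonneg_antisym:
  assumes "nonneg a" "nonneg (- a)"
  shows "a = 0"
proof -
  obtain s where s: "s \<in> rspec a" "\<bar>s\<bar> = norm a"
    using norm_in_rspec[of a] assms(1) by (auto simp: nonneg_def)
  then have "- s \<in> rspec (- a)"
    by (simp add: rspec_minus)
  then have "s = 0"
    using s(1) assms by (force simp: nonneg_def)
  with s show ?thesis
    by simp
qed

text \<open>\<open>c + adj c\<close> and \<open>i (c - adj c)\<close> are, up to sign, twice the
  real and imaginary parts of \<open>c\<close>. The mixed terms cancel in the sum of their
  squares.\<close>

lemma nonneg_mult_adj_add:
  "nonneg (2 *\<^sub>R (adj c * c + c * adj c))"
proof -
  let ?u = "c + adj c" and ?v = "\<i> *\<^sub>C (c - adj c)"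
  have v: "adj ?v = ?v"
    by (simp add: adj_scaleC adj_diff adj_adj scaleC_minus_left scaleC_diff_right)
  have "?v * ?v = - ((c - adj c) * (c - adj c))"
    by (simp add: mult_scaleC_left mult_scaleC_right scaleC_scaleC scaleC_minus_one)
  then have "?u * ?u + ?v * ?v = 2 *\<^sub>R (adj c * c + c * adj c)"
    by (simp add: algebra_simps scaleR_2)
  moreover have "nonneg (?u * ?u + ?v * ?v)"
    by (intro nonneg_add nonneg_square v) (simp add: adj_add adj_adj add.commute)
  ultimately show ?thesis
    by simp
qed

text \<open>Adding \<open>- adj c * c\<close> to the positive element
  \<open>adj c * c + c * adj c\<close> shows that \<open>c * adj c\<close> is positive. Off 0 it has
  the same spectrum as \<open>adj c * c\<close>, which is therefore positive together with its
  negative.\<close>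

lemma adj_mult_nonpos_imp_0:
  assumes "nonneg (- (adj c * c))"
  shows "c = 0"
proof -
  have "nonneg (2 *\<^sub>R (adj c * c + c * adj c) + 2 *\<^sub>R (- (adj c * c)))"
    by (intro nonneg_add nonneg_mult_adj_add nonneg_scaleR assms) simp
  then have "nonneg ((1/2) *\<^sub>R (2 *\<^sub>R (c * adj c)))"
    by (intro nonneg_scaleR[of "2 *\<^sub>R (c * adj c)"]) (simp_all add: scaleR_add_right)
  then have n: "nonneg (c * adj c)"
    by simp
  have "nonneg (adj c * c)"
    unfolding nonneg_def
  proof (intro conjI ballI)
    fix t assume "t \<in> rspec (adj c * c)"
    then have "t = 0 \<or> t \<in> rspec (c * adj c)"
      using rspec_mult_commute by blast
    with n show "t \<ge> 0"
      by (auto simp: nonneg_def)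
  qed (simp add: adj_mult adj_adj)
  with assms have "adj c * c = 0"
    using nonneg_antisym by blast
  then show ?thesis
    using cstar_identity[of c] by simp
qed

text \<open>
  Kaplansky's argument: with \<open>x = b\<^sup>* b\<close>, the element \<open>c = b x\<^sub>-\<close> satisfies \<open>c\<^sup>* c = - x\<^sub>-\<^sup>3\<close>,
  which forces \<open>c = 0\<close> and hence \<open>x\<^sub>- = 0\<close>.
\<close>

lemma nonneg_adj_mult: "nonneg (adj b * b)"
proof -
  define x where "x = adj b * b"
  have x: "adj x = x"
    by (simp add: x_def adj_mult adj_adj)
  define n where "n = fcalc (\<lambda>t. max 0 (- t)) x"
  have cn: "continuous_on UNIV (\<lambda>t::real. max 0 (- t))"
    by (intro continuous_intros)
  have n: "adj n = n"
    unfolding n_def by (rule adj_fcalc[OF x cn])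
  have c: "n * x = fcalc (\<lambda>t. max 0 (- t) * t) x" "n * n = fcalc (\<lambda>t. max 0 (- t) * max 0 (- t)) x"
    unfolding n_def using fcalc_mult[OF x cn continuous_on_id] fcalc_mult[OF x cn cn] fcalc_id[OF x]
    by (simp_all add: id_def)
  have "adj (b * n) * (b * n) = n * x * n"
    by (simp add: adj_mult n x_def mult.assoc)
  also have "\<dots> = fcalc (\<lambda>t. max 0 (- t) * t * max 0 (- t)) x"
    unfolding c unfolding n_def by (rule fcalc_mult[symmetric]) (auto intro!: x continuous_intros)
  finally have "- (adj (b * n) * (b * n)) = fcalc (\<lambda>t. (-1) * (max 0 (- t) * t * max 0 (- t))) x"
    by (subst fcalc_scale) (auto intro!: x continuous_intros)
  also have "nonneg \<dots>"
  proof (rule nonneg_fcalc[OF x])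
    show "continuous_on UNIV (\<lambda>t::real. (-1) * (max 0 (- t) * t * max 0 (- t)))"
      by (intro continuous_intros)
  qed (simp add: max_def mult_nonneg_nonpos)
  finally have "b * n = 0"
    by (rule adj_mult_nonpos_imp_0)
  then have "x * n * n = 0"
    by (simp add: x_def mult.assoc)
  then have "fcalc (\<lambda>t. t * (max 0 (- t) * max 0 (- t))) x = 0"
    using fcalc_mult[OF x continuous_on_id continuous_on_mult[OF cn cn]] fcalc_id[OF x] c(2)
    by (simp add: id_def mult.assoc)
  have "n = 0"
  proof -
    have "fcalc (\<lambda>t. max 0 (- t) * max 0 (- t)) x * fcalc (\<lambda>t. max 0 (- t) * max 0 (- t)) x =
       fcalc (\<lambda>t. (max 0 (- t) * max 0 (- t)) * (max 0 (- t) * max 0 (- t))) x"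
      by (rule fcalc_mult[symmetric]) (auto intro!: x continuous_intros)
    \<comment> \<open>With \<open>m = max 0 (- t)\<close> one has
      \<open>t * m = - m\<^sup>2\<close>, so the fourth power of \<open>m\<close> is
      \<open>- m\<close> times \<open>t * m\<^sup>2\<close>, whose calculus is already zero. The
      C*-identity then brings the fourth power of \<open>n\<close> down to \<open>n\<close>.\<close>
    also have "\<dots> = fcalc (\<lambda>t. (- max 0 (- t)) * (t * (max 0 (- t) * max 0 (- t)))) x"
      by (rule fcalc_cong[OF x], (intro continuous_intros)+) (simp add: max_def)
    also have "\<dots> = fcalc (\<lambda>t. - max 0 (- t)) x * fcalc (\<lambda>t. t * (max 0 (- t) * max 0 (- t))) x"
      by (rule fcalc_mult) (auto intro!: x continuous_intros)
    also have "\<dots> = 0"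
      using \<open>fcalc (\<lambda>t. t * (max 0 (- t) * max 0 (- t))) x = 0\<close> by simp
    finally have "(n * n) * (n * n) = 0"
      by (simp only: c(2))
    then have "norm (n * n) = 0"
      using norm_square_selfadj[of "n * n"] by (simp add: adj_mult n)
    then show "n = 0"
      using norm_square_selfadj[OF n] by simp
  qed
  have "x = fcalc (\<lambda>t. max 0 t - max 0 (- t)) x"
    by (subst fcalc_id[OF x, symmetric], rule fcalc_cong) (auto intro!: x continuous_intros)
  also have "\<dots> = fcalc (\<lambda>t. max 0 t) x - n"
    unfolding n_def by (rule fcalc_diff) (auto intro!: x continuous_intros)
  also have "\<dots> = fcalc (\<lambda>t. max 0 t) x"
    using \<open>n = 0\<close> by simp
  also have "nonneg \<dots>"
    by (rule nonneg_fcalc) (auto intro!: x continuous_intros)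
  finally show ?thesis
    by (simp add: x_def)
qed

text \<open>The square root vanishes at 0, so the root of \<open>a\<close> stays in
  \<open>B\<close>; this yields positivity relative to \<open>B\<close>, as gTA\<Omega>
  demands.\<close>

lemma nonneg_imp_positive_in:
  assumes "nonneg a" "cstar_subalgebra B" "a \<in> B"
  shows "positive_in B a"
proof -
  have a: "adj a = a"
    using assms by (simp add: nonneg_def)
  let ?s = "fcalc (\<lambda>t. sqrt (max 0 t)) a"
  have c: "continuous_on UNIV (\<lambda>t. sqrt (max 0 t))"
    by (intro continuous_intros)
  have "a = fcalc (\<lambda>t. t) a"
    using fcalc_id[OF a] by simp
  also have "\<dots> = ?s * ?s"
    by (rule fcalc_square) (use assms in \<open>auto simp: nonneg_def intro: continuous_intros\<close>)
  finally have "a = adj ?s * ?s"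
    using adj_fcalc[OF a c] by simp
  moreover have "?s \<in> B"
    by (rule fcalc_in_subalgebra[OF a c _ assms(2,3)]) simp
  ultimately show ?thesis
    unfolding positive_in_def by blast
qed

lemma positive_in_imp_nonneg: "positive_in B a \<Longrightarrow> nonneg a"
  by (auto simp: positive_in_def nonneg_adj_mult)

lemma cstar_subalgebra_UNIV: "cstar_subalgebra UNIV"
  by (simp add: cstar_subalgebra_def)

lemma positive_iff_nonneg: "positive a \<longleftrightarrow> nonneg a"
  using positive_in_imp_nonneg nonneg_imp_positive_in[OF _ cstar_subalgebra_UNIV] by blast

lemma norm_le_if_nonneg_diff:
  assumes "nonneg a" "nonneg (N *\<^sub>R 1 - a)"
  shows "norm a \<le> N"
proof -
  obtain s where s: "s \<in> rspec a" "\<bar>s\<bar> = norm a"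
    using norm_in_rspec[of a] assms(1) by (auto simp: nonneg_def)
  then have "N - s \<in> rspec (N *\<^sub>R 1 - a)"
    by (simp add: rspec_scalar_minus)
  with s assms show ?thesis
    by (force simp: nonneg_def)
qed

lemma norm_add_nonneg_mono:
  assumes "nonneg a" "nonneg b"
  shows "norm a \<le> norm (a + b)"
proof (rule norm_le_if_nonneg_diff[OF assms(1)])
  have "nonneg (norm (a + b) *\<^sub>R 1 - (a + b))"
    unfolding nonneg_def
  proof (intro conjI ballI)
    fix t assume "t \<in> rspec (norm (a + b) *\<^sub>R 1 - (a + b))"
    then have "norm (a + b) - t \<in> rspec (a + b)"
      by (simp add: rspec_scalar_minus)
    from rspec_bound[OF this] show "t \<ge> 0"
      by linarith
  qed (use assms in \<open>simp add: nonneg_def adj_diff adj_scaleR adj_add\<close>)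
  from nonneg_add[OF this assms(2)] show "nonneg (norm (a + b) *\<^sub>R 1 - a)"
    by (simp add: algebra_simps)
qed

section \<open>The calculus of \<open>fun_calc\<close>\<close>

lemma quasi_inverse_iff:
  fixes u :: "'a::ring_1"
  shows "(\<exists>b. u + b - u * b = 0 \<and> u + b - b * u = 0) \<longleftrightarrow> invble (1 - u)"
proof
  assume "\<exists>b. u + b - u * b = 0 \<and> u + b - b * u = 0"
  then obtain b where "u + b - u * b = 0" "u + b - b * u = 0"
    by blast
  moreover have "(1 - u) * (1 - b) = 1 - (u + b - u * b)" "(1 - b) * (1 - u) = 1 - (u + b - b * u)"
    by (simp_all add: algebra_simps)
  ultimately show "invble (1 - u)"
    unfolding invble_def isinv_def by (metis diff_zero)
next
  assume "invble (1 - u)"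
  then obtain c where "(1 - u) * c = 1" "c * (1 - u) = 1"
    by (auto simp: invble_def isinv_def)
  then show "\<exists>b. u + b - u * b = 0 \<and> u + b - b * u = 0"
    by (intro exI[of _ "1 - c"]) (simp add: algebra_simps)
qed

lemma spectrum_unital:
  fixes a :: "'a::unital_cstar_algebra"
  shows "spectrum a = insert 0 {z. \<not> invble (z *\<^sub>C 1 - a)}"
proof -
  have "invble (1 - inverse z *\<^sub>C a) \<longleftrightarrow> invble (z *\<^sub>C 1 - a)" if "z \<noteq> 0" for z
  proof -
    have "z *\<^sub>C (1 - inverse z *\<^sub>C a) = z *\<^sub>C 1 - a" "inverse z *\<^sub>C (z *\<^sub>C 1 - a) = 1 - inverse z *\<^sub>C a"
      using that by (simp_all add: scaleC_diff_right scaleC_scaleC scaleC_one)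
    then show ?thesis
      using invble_scaleC[of z "1 - inverse z *\<^sub>C a"] invble_scaleC[of "inverse z" "z *\<^sub>C 1 - a"] that
      by auto
  qed
  then show ?thesis
    unfolding spectrum_def quasi_inverse_iff by auto
qed

lemma rspec_in_spectrum: "t \<in> rspec a \<Longrightarrow> complex_of_real t \<in> spectrum a"
  by (simp add: spectrum_unital rspec_def scaleR_scaleC)

lemma spectrum_selfadj:
  fixes a :: "'a::unital_cstar_algebra"
  assumes "adj a = a" "z \<in> spectrum a"
  shows "\<exists>t\<in>{- norm a..norm a}. z = complex_of_real t"
proof (cases "z = 0")
  case False
  with assms(2) have z: "\<not> invble (z *\<^sub>C 1 - a)"
    by (auto simp: spectrum_unital)
  have "Im z = 0"
  proof (rule ccontr)
    assume "Im z \<noteq> 0"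
    then have "invble ((a - Re z *\<^sub>R 1) + (\<i> * complex_of_real (- Im z)) *\<^sub>C 1)"
      using assms(1) by (intro invble_add_imaginary) (auto simp: adj_diff adj_scaleR)
    moreover have eq: "z *\<^sub>C (1::'a) = Re z *\<^sub>R 1 - (\<i> * complex_of_real (- Im z)) *\<^sub>C 1"
    proof -
      have "z = complex_of_real (Re z) - \<i> * complex_of_real (- Im z)"
        by (simp add: complex_eq_iff)
      then have "z *\<^sub>C (1::'a) = (complex_of_real (Re z) - \<i> * complex_of_real (- Im z)) *\<^sub>C 1"
        by (rule arg_cong)
      then show ?thesis
        by (simp only: scaleC_diff_left scaleR_scaleC)
    qed
    have "- (u - w - a) = (a - u) + w" for u w :: 'a
      by simp
    then have "- (z *\<^sub>C 1 - a) = (a - Re z *\<^sub>R 1) + (\<i> * complex_of_real (- Im z)) *\<^sub>C 1"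
      unfolding eq .
    ultimately have "invble (- (z *\<^sub>C 1 - a))"
      by metis
    with z show False
      by (simp only: invble_minus)
  qed
  then have zr: "z = complex_of_real (Re z)"
    by (simp add: complex_eq_iff)
  with z have "Re z \<in> rspec a"
    by (metis mem_Collect_eq rspec_def scaleR_scaleC)
  from rspec_bound[OF this] zr show ?thesis
    by (intro bexI[of _ "Re z"]) auto
qed (auto intro: bexI[of _ 0])

text \<open>Any \<open>n\<close> beyond the nonzero coefficients is allowed: the real and imaginary
  parts of a complex polynomial may have smaller degree but must be summed over one range.\<close>

lemma rpoly_sum:
  assumes "\<And>i. i \<ge> n \<Longrightarrow> coeff q i = 0"
  shows "rpoly q a = (\<Sum>i<n. coeff q i *\<^sub>R a ^ i)"
  using assms
proof (induction q arbitrary: n)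
  case (pCons c q)
  from pCons.hyps have "lead_coeff (pCons c q) \<noteq> 0"
    by (simp only: leading_coeff_0_iff) auto
  with pCons.prems[of "degree (pCons c q)"] have "n \<noteq> 0"
    by linarith
  then obtain m where n: "n = Suc m"
    using not0_implies_Suc by blast
  have "coeff q i = 0" if "i \<ge> m" for i
    using pCons.prems[of "Suc i"] that n by simp
  from pCons.IH[OF this] show ?case
    unfolding n sum.lessThan_Suc_shift by (simp add: sum_distrib_left)
qed simp

lemma poly_calc_pCons_0:
  fixes a :: "'a::unital_cstar_algebra"
  shows "poly_calc (pCons 0 r) a =
    rpoly (pCons 0 (map_poly Re r)) a + \<i> *\<^sub>C rpoly (pCons 0 (map_poly Im r)) a"
proof -
  let ?n = "degree (pCons 0 r)"
  \<comment> \<open>The prefix \<open>pCons 0\<close> shifts indices by one, so the range of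
    \<open>poly_calc\<close> for \<open>pCons 0 r\<close> covers all coefficients of
    \<open>r\<close>.\<close>
  have r: "coeff r i = 0" if "i \<ge> ?n" for i
    using that by (cases "r = 0") (auto simp: coeff_eq_0)
  have R: "rpoly (map_poly Re r) a = (\<Sum>i<?n. Re (coeff r i) *\<^sub>R a ^ i)"
    using r by (subst rpoly_sum[of ?n]) (simp_all add: coeff_map_poly)
  have I: "rpoly (map_poly Im r) a = (\<Sum>i<?n. Im (coeff r i) *\<^sub>R a ^ i)"
    using r by (subst rpoly_sum[of ?n]) (simp_all add: coeff_map_poly)
  have p: "((*) a ^^ i) a = a * a ^ i" for i
    by (induction i) simp_all
  have s: "\<i> *\<^sub>C sum f A = (\<Sum>i\<in>A. \<i> *\<^sub>C (f i :: 'a))" for f :: "nat \<Rightarrow> 'a" and A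
    by (induction A rule: infinite_finite_induct) (simp_all add: scaleC_add_right)
  have c: "z *\<^sub>C x = Re z *\<^sub>R x + \<i> *\<^sub>C (Im z *\<^sub>R (x::'a))" for z x
    by (simp add: scaleR_scaleC scaleC_scaleC flip: scaleC_add_left complex_eq)
  have "poly_calc (pCons 0 r) a = (\<Sum>i<?n. coeff r i *\<^sub>C (a * a ^ i))"
    unfolding poly_calc_def by (simp only: p coeff_pCons_Suc)
  also have "\<dots> = (\<Sum>i<?n. Re (coeff r i) *\<^sub>R (a * a ^ i) + \<i> *\<^sub>C (Im (coeff r i) *\<^sub>R (a * a ^ i)))"
    by (rule sum.cong[OF refl]) (rule c)
  also have "\<dots> = a * rpoly (map_poly Re r) a + \<i> *\<^sub>C (a * rpoly (map_poly Im r) a)"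
    unfolding R I by (simp only: sum.distrib sum_distrib_left s mult_scaleR_right)
  finally show ?thesis
    by simp
qed

lemma poly_Re_Im:
  "poly r (complex_of_real t) =
     Complex (poly (map_poly Re r) t) (poly (map_poly Im r) t)"
  by (induction r) (simp_all add: map_poly_pCons complex_eq_iff)

text \<open>The description operator needs existence and uniqueness. Existence comes from real
  polynomials approximating \<open>g\<close> on an interval that contains the spectrum together with
  the adjoined 0.\<close>

lemma fun_calc_eq_fcalc:
  assumes a: "adj a = a" and g: "continuous_on UNIV g" "g 0 = 0"
    and f: "\<And>t. f (complex_of_real t) = complex_of_real (g t)"
  shows "fun_calc f a = fcalc g a"
  unfolding fun_calc_def
proof (rule the_equality)
  obtain q where q: "uniform_limit {- norm a..norm a} (\<lambda>n. poly (pCons 0 (q n))) g sequentially"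
    using Weierstrass_poly_seq_0[OF g, of "norm a"] by auto
  let ?p = "\<lambda>n. pCons 0 (map_poly complex_of_real (q n))"
  have re: "map_poly Re (map_poly complex_of_real r) = r" "map_poly Im (map_poly complex_of_real r) = 0" for r
    by (auto intro!: poly_eqI simp: coeff_map_poly)
  have pr: "poly (?p n) (complex_of_real t) = complex_of_real (poly (pCons 0 (q n)) t)" for n t
    by (simp add: poly_Re_Im re complex_eq_iff map_poly_pCons)
  have "uniform_limit (spectrum a) (\<lambda>n. poly (?p n)) f sequentially"
  proof (rule uniform_limitI)
    fix e :: real assume "e > 0"
    from uniform_limitD[OF q this]
    show "\<forall>\<^sub>F n in sequentially. \<forall>z\<in>spectrum a. dist (poly (?p n) z) (f z) < e"
    proof (rule eventually_mono)
      fix n assume n: "\<forall>t\<in>{- norm a..norm a}. dist (poly (pCons 0 (q n)) t) (g t) < e"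
      show "\<forall>z\<in>spectrum a. dist (poly (?p n) z) (f z) < e"
      proof
        fix z assume "z \<in> spectrum a"
        then obtain t where t: "t \<in> {- norm a..norm a}" "z = complex_of_real t"
          using spectrum_selfadj[OF a] by blast
        show "dist (poly (?p n) z) (f z) < e"
          using n t(1) unfolding t(2) f pr dist_of_real by blast
      qed
    qed
  qed
  moreover have "(\<lambda>n. poly_calc (?p n) a) \<longlonglongrightarrow> fcalc g a"
    using fcalc_tendsto[OF a g(1) uniform_limit_on_subset[OF q rspec_subset[OF order_refl]]]
    by (simp add: poly_calc_pCons_0 re)
  ultimately show "\<exists>p. (\<forall>n. poly (p n) 0 = 0) \<and>
     uniform_limit (spectrum a) (\<lambda>n. poly (p n)) f sequentially \<and>
     (\<lambda>n. poly_calc (p n) a) \<longlonglongrightarrow> fcalc g a"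
    by (intro exI[of _ ?p]) simp
next
  fix b assume "\<exists>p. (\<forall>n. poly (p n) 0 = 0) \<and>
     uniform_limit (spectrum a) (\<lambda>n. poly (p n)) f sequentially \<and>
     (\<lambda>n. poly_calc (p n) a) \<longlonglongrightarrow> b"
  then obtain p where p: "\<And>n. poly (p n) 0 = 0"
     and u: "uniform_limit (spectrum a) (\<lambda>n. poly (p n)) f sequentially"
     and b: "(\<lambda>n. poly_calc (p n) a) \<longlonglongrightarrow> b"
    by blast
  have "\<exists>r. p n = pCons 0 r" for n
    using p[of n] by (cases "p n") auto
  then obtain r where r: "\<And>n. p n = pCons 0 (r n)"
    by metis
  \<comment> \<open>Uniqueness: on real spectral values the real parts converge to \<open>g\<close>
    and the imaginary parts to 0, so every admissible sequence has the limit
    \<open>fcalc g a\<close>.\<close>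
  let ?x = "\<lambda>n. pCons 0 (map_poly Re (r n))" and ?y = "\<lambda>n. pCons 0 (map_poly Im (r n))"
  have ri: "poly (?x n) t = Re (poly (p n) (complex_of_real t))"
    "poly (?y n) t = Im (poly (p n) (complex_of_real t))" for n t
    by (simp_all add: r poly_Re_Im map_poly_pCons)
  have x: "uniform_limit (rspec a) (\<lambda>n. poly (?x n)) g sequentially"
    and y: "uniform_limit (rspec a) (\<lambda>n. poly (?y n)) (\<lambda>t. 0) sequentially"
    unfolding uniform_limit_iff
  proof (safe)
    fix e :: real assume "e > 0"
    from uniform_limitD[OF u this]
    have *: "\<forall>\<^sub>F n in sequentially. \<forall>t\<in>rspec a. cmod (poly (p n) (complex_of_real t) - complex_of_real (g t)) < e"
    proof (rule eventually_mono)
      fix n assume n: "\<forall>z\<in>spectrum a. dist (poly (p n) z) (f z) < e"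
      show "\<forall>t\<in>rspec a. cmod (poly (p n) (complex_of_real t) - complex_of_real (g t)) < e"
      proof
        fix t assume "t \<in> rspec a"
        from bspec[OF n rspec_in_spectrum[OF this]]
        show "cmod (poly (p n) (complex_of_real t) - complex_of_real (g t)) < e"
          by (simp add: dist_norm f)
      qed
    qed
    show "\<forall>\<^sub>F n in sequentially. \<forall>t\<in>rspec a. dist (poly (?x n) t) (g t) < e"
      using *
    proof (rule eventually_mono)
      fix n assume n: "\<forall>t\<in>rspec a. cmod (poly (p n) (complex_of_real t) - complex_of_real (g t)) < e"
      show "\<forall>t\<in>rspec a. dist (poly (?x n) t) (g t) < e"
      proof
        fix t assume "t \<in> rspec a"
        from bspec[OF n this] abs_Re_le_cmod[of "poly (p n) (complex_of_real t) - complex_of_real (g t)"]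
        show "dist (poly (?x n) t) (g t) < e"
          unfolding ri dist_real_def by simp
      qed
    qed
    show "\<forall>\<^sub>F n in sequentially. \<forall>t\<in>rspec a. dist (poly (?y n) t) 0 < e"
      using *
    proof (rule eventually_mono)
      fix n assume n: "\<forall>t\<in>rspec a. cmod (poly (p n) (complex_of_real t) - complex_of_real (g t)) < e"
      show "\<forall>t\<in>rspec a. dist (poly (?y n) t) 0 < e"
      proof
        fix t assume "t \<in> rspec a"
        from bspec[OF n this] abs_Im_le_cmod[of "poly (p n) (complex_of_real t) - complex_of_real (g t)"]
        show "dist (poly (?y n) t) 0 < e"
          unfolding ri dist_real_def by simp
      qed
    qed
  qed
  have X: "(\<lambda>n. rpoly (?x n) a) \<longlonglongrightarrow> fcalc g a"
    by (rule fcalc_tendsto[OF a g(1) x])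
  have Y: "(\<lambda>n. rpoly (?y n) a) \<longlonglongrightarrow> 0"
    using fcalc_tendsto[OF a continuous_on_const y] fcalc_const[OF a, of 0] by (simp only: scaleR_zero_left)
  have "(\<lambda>n. \<i> *\<^sub>C rpoly (?y n) a) \<longlonglongrightarrow> 0"
    by (rule tendsto_norm_zero_cancel) (simp only: norm_scaleC norm_ii mult_1 tendsto_norm_zero[OF Y])
  from tendsto_add[OF X this] have "(\<lambda>n. poly_calc (p n) a) \<longlonglongrightarrow> fcalc g a"
    by (simp add: r poly_calc_pCons_0)
  with b show "b = fcalc g a"
    by (rule LIMSEQ_unique)
qed

lemma cut_down_eq_fcalc:
  assumes "adj a = a" "\<epsilon> \<ge> 0"
  shows "cut_down a \<epsilon> = fcalc (\<lambda>t. max 0 (t - \<epsilon>)) a"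
  unfolding cut_down_def
  by (rule fun_calc_eq_fcalc) (use assms in \<open>auto intro!: continuous_intros\<close>)

section \<open>Cuntz subequivalence of elements\<close>

text \<open>One summand of a sum of positive elements is dominated by the sum, and the norm is
  monotone on positive elements.\<close>

lemma norm_le_col_norm:
  fixes x :: "nat \<Rightarrow> 'a::unital_cstar_algebra"
  assumes "finite {i. x i \<noteq> 0}"
  shows "norm (x i) \<le> col_norm x"
proof -
  let ?A = "insert i {i. x i \<noteq> 0}"
  have nn: "nonneg (\<Sum>j\<in>A. adj (x j) * x j)" for A
    by (induction A rule: infinite_finite_induct) (simp_all add: nonneg_add nonneg_adj_mult)
  have "Sum_any (\<lambda>j. adj (x j) * x j) = (\<Sum>j\<in>?A. adj (x j) * x j)"
    by (rule Sum_any.expand_superset) (use assms in auto)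
  also have "\<dots> = adj (x i) * x i + (\<Sum>j\<in>?A - {i}. adj (x j) * x j)"
    using assms by (intro sum.remove) auto
  finally have "norm (adj (x i) * x i) \<le> norm (Sum_any (\<lambda>j. adj (x j) * x j))"
    using norm_add_nonneg_mono[OF nonneg_adj_mult nn] by simp
  then show ?thesis
    unfolding col_norm_def cstar_identity by (simp add: real_le_rsqrt)
qed

lemma col_norm_single: "col_norm (\<lambda>i. if i = k then d else 0) = norm (d::'a::unital_cstar_algebra)"
proof -
  have "Sum_any (\<lambda>i. adj (if i = k then d else 0) * (if i = k then d else 0)) =
      (\<Sum>i\<in>{k}. adj (if i = k then d else 0) * (if i = k then d else 0))"
    by (rule Sum_any.expand_superset) auto
  then show ?thesis
    by (simp add: col_norm_def cstar_identity)
qed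

lemma M_infty_bound:
  assumes "S \<in> M_infty"
  shows "\<exists>n. \<forall>i j. S i j \<noteq> 0 \<longrightarrow> i < n \<and> j < n"
proof -
  have "finite ((\<lambda>(i, j). max i j) ` {(i, j). S i j \<noteq> 0})"
    using assms by (simp add: M_infty_def)
  then obtain m where m: "\<forall>k\<in>(\<lambda>(i, j). max i j) ` {(i, j). S i j \<noteq> 0}. k < m"
    unfolding finite_nat_set_iff_bounded by blast
  have "i < m \<and> j < m" if "S i j \<noteq> 0" for i j
  proof -
    have "max i j \<in> (\<lambda>(i, j). max i j) ` {(i, j). S i j \<noteq> 0}"
      using that by (intro image_eqI[of _ _ "(i, j)"]) auto
    with m show ?thesis
      by fastforce
  qed
  then show ?thesis
    by blast
qed

text \<open>The first basis column is a test vector. A real supremum dominates its members only if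
  the set is bounded above; the entrywise norms of the finitely many nonzero entries give a crude
  bound.\<close>

lemma norm_entry_le_mat_norm:
  fixes S :: "'a::unital_cstar_algebra inf_matrix"
  assumes "S \<in> M_infty"
  shows "norm (S 0 0) \<le> mat_norm S"
proof -
  obtain n where n: "\<And>i j. S i j \<noteq> 0 \<Longrightarrow> i < n \<and> j < n"
    using M_infty_bound[OF assms] by blast
  let ?X = "{x. finite {i. x i \<noteq> 0} \<and> col_norm x \<le> 1} :: (nat \<Rightarrow> 'a) set"
  let ?y = "\<lambda>x i. Sum_any (\<lambda>j. S i j * x j)"
  have y: "?y x i = (\<Sum>j<n. S i j * x j)" for x i
  proof (rule Sum_any.expand_superset)
    show "{j. S i j * x j \<noteq> 0} \<subseteq> {..<n}"
    proof
      fix j assume "j \<in> {j. S i j * x j \<noteq> 0}"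
      then have "S i j \<noteq> 0"
        by auto
      with n show "j \<in> {..<n}"
        by simp
    qed
  qed simp
  have y0: "?y x i = 0" if "i \<ge> n" for x i
    using that n[of i] unfolding y by (intro sum.neutral) fastforce
  have fin: "finite {i. ?y x i \<noteq> 0}" for x
    by (rule finite_subset[of _ "{..<n}"]) (use y0 in \<open>auto simp: not_less[symmetric]\<close>)
  have "bdd_above ((\<lambda>x. col_norm (?y x)) ` ?X)"
  proof (rule bdd_aboveI2)
    fix x assume x: "x \<in> ?X"
    have e: "norm (?y x i) \<le> (\<Sum>j<n. norm (S i j))" for i
    proof -
      have "norm (S i j * x j) \<le> norm (S i j)" for j
      proof -
        have "norm (x j) \<le> 1"
          using norm_le_col_norm[of x j] x by simp
        then show ?thesis
          by (metis mult.right_neutral mult_left_mono norm_ge_zero norm_mult_ineq order_trans)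
      qed
      then show ?thesis
        unfolding y by (intro sum_norm_le)
    qed
    have "Sum_any (\<lambda>i. adj (?y x i) * ?y x i) = (\<Sum>i<n. adj (?y x i) * ?y x i)"
    proof (rule Sum_any.expand_superset)
      show "{i. adj (?y x i) * ?y x i \<noteq> 0} \<subseteq> {..<n}"
        using y0[of _ x] by (metis (mono_tags, lifting) lessThan_iff mem_Collect_eq mult_zero_right not_less subsetI)
    qed simp
    then have "norm (Sum_any (\<lambda>i. adj (?y x i) * ?y x i)) \<le> (\<Sum>i<n. (norm (?y x i))\<^sup>2)"
      using sum_norm_le[of "{..<n}" "\<lambda>i. adj (?y x i) * ?y x i" "\<lambda>i. (norm (?y x i))\<^sup>2"]
      by (simp add: cstar_identity)
    also have "\<dots> \<le> (\<Sum>i<n. (\<Sum>j<n. norm (S i j))\<^sup>2)"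
      by (intro sum_mono power_mono e) simp
    finally show "col_norm (?y x) \<le> sqrt (\<Sum>i<n. (\<Sum>j<n. norm (S i j))\<^sup>2)"
      unfolding col_norm_def by simp
  qed
  moreover have "(\<lambda>i. if i = 0 then 1 else 0) \<in> ?X"
    by (simp add: col_norm_single)
  ultimately have "col_norm (?y (\<lambda>i. if i = 0 then 1 else 0)) \<le> mat_norm S"
    unfolding mat_norm_def by (rule cSUP_upper[rotated])
  moreover have "?y (\<lambda>i. if i = 0 then 1 else 0) 0 = S 0 0"
  proof -
    have "?y (\<lambda>i. if i = 0 then 1 else 0) 0 = (\<Sum>j\<in>{0}. S 0 j * (if j = 0 then 1 else 0))"
      by (rule Sum_any.expand_superset) auto
    then show ?thesis
      by simp
  qed
  ultimately show ?thesis
    using norm_le_col_norm[OF fin[of "\<lambda>i. if i = 0 then 1 else 0"], of 0] by simp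
qed

lemma mat_norm_corner_le: "mat_norm (corner d) \<le> norm (d::'a::unital_cstar_algebra)"
  unfolding mat_norm_def
proof (rule cSUP_least)
  show "{x. finite {i. x i \<noteq> 0} \<and> col_norm x \<le> 1} \<noteq> ({} :: (nat \<Rightarrow> 'a) set)"
    using col_norm_single[of 0 "0::'a"] by (auto intro!: exI[of _ "\<lambda>i. 0"])
next
  fix x :: "nat \<Rightarrow> 'a" assume x: "x \<in> {x. finite {i. x i \<noteq> 0} \<and> col_norm x \<le> 1}"
  have "Sum_any (\<lambda>j. corner d i j * x j) = (\<Sum>j\<in>{0}. corner d i j * x j)" for i
    by (rule Sum_any.expand_superset) (auto simp: corner_def)
  then have "(\<lambda>i. Sum_any (\<lambda>j. corner d i j * x j)) = (\<lambda>i. if i = 0 then d * x 0 else 0)"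
    by (auto simp: corner_def)
  then have "col_norm (\<lambda>i. Sum_any (\<lambda>j. corner d i j * x j)) = norm (d * x 0)"
    by (simp add: col_norm_single)
  also have "\<dots> \<le> norm d * norm (x 0)"
    by (rule norm_mult_ineq)
  also have "\<dots> \<le> norm d * 1"
    using norm_le_col_norm[of x 0] x by (intro mult_left_mono) auto
  finally show "col_norm (\<lambda>i. Sum_any (\<lambda>j. corner d i j * x j)) \<le> norm d"
    by simp
qed

lemma mat_conj_corner:
  "mat_mult (mat_mult v (corner b)) (mat_adj v) = (\<lambda>i j. v i 0 * b * adj (v j 0))"
proof (intro ext)
  fix i j
  have 1: "mat_mult v (corner b) i k = (if k = 0 then v i 0 * b else 0)" for k
  proof -
    have "mat_mult v (corner b) i k = (\<Sum>l\<in>{0}. v i l * corner b l k)"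
      unfolding mat_mult_def by (rule Sum_any.expand_superset) (auto simp: corner_def)
    then show ?thesis
      by (simp add: corner_def)
  qed
  have "mat_mult (mat_mult v (corner b)) (mat_adj v) i j =
      (\<Sum>k\<in>{0}. mat_mult v (corner b) i k * mat_adj v k j)"
    unfolding mat_mult_def[of "mat_mult v (corner b)"]
    by (rule Sum_any.expand_superset) (auto simp: 1)
  then show "mat_mult (mat_mult v (corner b)) (mat_adj v) i j = v i 0 * b * adj (v j 0)"
    by (simp add: 1 mat_adj_def)
qed

lemma corner_in_M_infty: "corner d \<in> M_infty"
proof -
  have "{(i, j). corner d i j \<noteq> 0} \<subseteq> {(0, 0)}"
    by (auto simp: corner_def split: if_splits)
  then show ?thesis
    by (auto simp: M_infty_def intro: finite_subset)
qed

lemma conj_corner_diff_in_M_infty: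
  assumes "v \<in> M_infty"
  shows "mat_mult (mat_mult v (corner b)) (mat_adj v) - corner a \<in> M_infty"
proof -
  obtain n where n: "\<And>i j. v i j \<noteq> 0 \<Longrightarrow> i < n \<and> j < n"
    using M_infty_bound[OF assms] by blast
  have "{(i, j). (mat_mult (mat_mult v (corner b)) (mat_adj v) - corner a) i j \<noteq> 0}
      \<subseteq> {..n} \<times> {..n}"
  proof
    fix q assume "q \<in> {(i, j). (mat_mult (mat_mult v (corner b)) (mat_adj v) - corner a) i j \<noteq> 0}"
    then obtain i j where q: "q = (i, j)" "(mat_mult (mat_mult v (corner b)) (mat_adj v) - corner a) i j \<noteq> 0"
      by blast
    from q(2) have "(v i 0 \<noteq> 0 \<and> v j 0 \<noteq> 0) \<or> (i = 0 \<and> j = 0)"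
      unfolding mat_conj_corner fun_diff_def by (auto simp: corner_def split: if_splits)
    then show "q \<in> {..n} \<times> {..n}"
      using n[of i 0] n[of j 0] q(1) by auto
  qed
  then show ?thesis
    unfolding M_infty_def by (auto intro: finite_subset)
qed

text \<open>From matrices to elements, the entry at \<open>(0, 0)\<close> is extracted, which does
  not increase the norm and involves only the corner entry of \<open>v\<close>. Conversely, elements
  are placed in the corner.\<close>

lemma cuntz_le_iff:
  fixes a b :: "'a::unital_cstar_algebra"
  shows "a \<precsim> b \<longleftrightarrow> (\<forall>e>0. \<exists>v. norm (v * b * adj v - a) < e)"
proof
  assume "a \<precsim> b"
  then obtain v where v: "\<And>n. v n \<in> M_infty"
    and l: "(\<lambda>n. mat_norm (mat_mult (mat_mult (v n) (corner b)) (mat_adj (v n)) - corner a)) \<longlonglongrightarrow> 0"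
    unfolding cuntz_sub_def by blast
  show "\<forall>e>0. \<exists>v. norm (v * b * adj v - a) < e"
  proof (intro allI impI)
    fix e :: real assume "e > 0"
    from eventually_happens'[OF sequentially_bot order_tendstoD(2)[OF l this]]
    obtain n where "mat_norm (mat_mult (mat_mult (v n) (corner b)) (mat_adj (v n)) - corner a) < e"
      by blast
    moreover have "(mat_mult (mat_mult (v n) (corner b)) (mat_adj (v n)) - corner a) 0 0 =
        v n 0 0 * b * adj (v n 0 0) - a"
      unfolding mat_conj_corner fun_diff_def by (simp add: corner_def)
    ultimately show "\<exists>v. norm (v * b * adj v - a) < e"
      using norm_entry_le_mat_norm[OF conj_corner_diff_in_M_infty[OF v[of n], of b a]]
      by (intro exI[of _ "v n 0 0"]) simp
  qed
next
  assume r: "\<forall>e>0. \<exists>v. norm (v * b * adj v - a) < e"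
  have "\<forall>n. \<exists>v. norm (v * b * adj v - a) < inverse (real (Suc n))"
    using r by (intro allI) (simp only: inverse_positive_iff_positive of_nat_0_less_iff zero_less_Suc)
  from choice[OF this] obtain w where w: "\<And>n. norm (w n * b * adj (w n) - a) < inverse (real (Suc n))"
    by blast
  have eq: "mat_mult (mat_mult (corner (w n)) (corner b)) (mat_adj (corner (w n))) - corner a
      = corner (w n * b * adj (w n) - a)" for n
    unfolding mat_conj_corner fun_diff_def by (intro ext) (simp add: corner_def)
  have "(\<lambda>n. mat_norm (corner (w n * b * adj (w n) - a))) \<longlonglongrightarrow> 0"
  proof (rule Lim_null_comparison[OF _ LIMSEQ_inverse_real_of_nat], rule always_eventually, rule allI)
    fix n
    have "0 \<le> mat_norm (corner (w n * b * adj (w n) - a))"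
      using norm_entry_le_mat_norm[OF corner_in_M_infty] norm_ge_zero order_trans by blast
    then show "norm (mat_norm (corner (w n * b * adj (w n) - a))) \<le> inverse (real (Suc n))"
      using mat_norm_corner_le[of "w n * b * adj (w n) - a"] w[of n] by simp
  qed
  then show "a \<precsim> b"
    unfolding cuntz_sub_def
    by (intro exI[of _ "\<lambda>n. corner (w n)"]) (simp only: corner_in_M_infty eq simp_thms)
qed

lemma cuntz_le_conj:
  assumes "z \<precsim> a"
  shows "w * z * adj w \<precsim> (a::'a::unital_cstar_algebra)"
  unfolding cuntz_le_iff
proof (intro allI impI)
  fix e :: real assume e: "e > 0"
  \<comment> \<open>Conjugation by \<open>w\<close> multiplies the error by at most the square of
    \<open>norm w\<close>; the added 1 keeps the quotient defined for \<open>w = 0\<close> and the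
    final inequality strict.\<close>
  define d where "d = e / ((norm w)\<^sup>2 + 1)"
  have "(norm w)\<^sup>2 + 1 > 0"
    by (simp add: add_nonneg_pos)
  with e have d: "d > 0" "((norm w)\<^sup>2 + 1) * d = e"
    by (simp_all add: d_def)
  then obtain v where v: "norm (v * a * adj v - z) < d"
    using assms unfolding cuntz_le_iff by blast
  have "(w * v) * a * adj (w * v) - w * z * adj w = w * (v * a * adj v - z) * adj w"
    by (simp add: adj_mult algebra_simps)
  also have "norm \<dots> \<le> norm w * norm (v * a * adj v - z) * norm w"
    using norm_mult_ineq[of w "v * a * adj v - z"] norm_mult_ineq[of "w * (v * a * adj v - z)" "adj w"]
    by (metis mult_right_mono norm_adj norm_ge_zero order_trans)
  also have "\<dots> = (norm w)\<^sup>2 * norm (v * a * adj v - z)"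
    by (simp add: power2_eq_square)
  also have "\<dots> \<le> (norm w)\<^sup>2 * d"
    using v by (intro mult_left_mono) auto
  also have "\<dots> < e"
    using d by (simp add: algebra_simps)
  finally show "\<exists>v. norm (v * a * adj v - w * z * adj w) < e"
    by blast
qed

lemma cuntz_le_scaleR:
  assumes "z \<precsim> a" "c \<ge> 0"
  shows "c *\<^sub>R z \<precsim> (a::'a::unital_cstar_algebra)"
  using cuntz_le_conj[OF assms(1), of "sqrt c *\<^sub>R 1"] assms(2) by (simp add: adj_scaleR)

text \<open>\<open>(t - \<epsilon>)\<^sub>+ = k(t) t k(t)\<close> for a continuous \<open>k\<close>, so \<open>(x - \<epsilon>)\<^sub>+\<close> is a conjugate of \<open>x\<close>.\<close>

lemma cut_down_cuntz_le:
  assumes x: "adj x = x" and e: "\<epsilon> > 0" and "x \<precsim> a"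
  shows "cut_down x \<epsilon> \<precsim> (a::'a::unital_cstar_algebra)"
proof -
  \<comment> \<open>The denominator \<open>max \<epsilon> t\<close> equals \<open>t\<close> wherever
    the numerator is nonzero and keeps \<open>k\<close> continuous on the whole line.\<close>
  define k where "k = (\<lambda>t. sqrt (max 0 (t - \<epsilon>) / max \<epsilon> t))"
  have k: "continuous_on UNIV k"
    unfolding k_def using e by (intro continuous_intros) (auto simp: max_def)
  have "k t * t * k t = max 0 (t - \<epsilon>)" for t
  proof (cases "t \<le> \<epsilon>")
    case False
    then have "k t * k t = (t - \<epsilon>) / t"
      using e by (simp add: k_def max_def real_sqrt_mult_self)
    then show ?thesis
      using False e by (simp add: mult.commute mult.left_commute)
  qed (simp add: k_def)
  then have "cut_down x \<epsilon> = fcalc (\<lambda>t. k t * t * k t) x"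
    using cut_down_eq_fcalc[OF x] e by simp
  also have "\<dots> = fcalc (\<lambda>t. k t * t) x * fcalc k x"
    by (rule fcalc_mult[OF x continuous_on_mult[OF k continuous_on_id] k])
  also have "fcalc (\<lambda>t. k t * t) x = fcalc k x * x"
    using fcalc_mult[OF x k continuous_on_id] fcalc_id[OF x] by (simp add: id_def)
  finally have "cut_down x \<epsilon> = fcalc k x * x * adj (fcalc k x)"
    by (simp add: adj_fcalc[OF x k])
  then show ?thesis
    using cuntz_le_conj[OF assms(3)] by simp
qed

section \<open>Comparison of the approximation classes\<close>

lemma nonneg_conj:
  assumes "nonneg z"
  shows "nonneg (adj w * z * w)"
proof -
  obtain c where "z = adj c * c"
    using assms by (auto simp: positive_in_def simp flip: positive_iff_nonneg)
  then have "adj w * z * w = adj (c * w) * (c * w)"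
    by (simp add: adj_mult mult.assoc)
  then show ?thesis
    using nonneg_adj_mult by simp
qed

lemma nonneg_one_minus_projection:
  assumes "adj p = p" "p * p = p"
  shows "nonneg (1 - p)"
  using nonneg_square[of "1 - p"] assms by (simp add: adj_diff algebra_simps)

text \<open>The left side of \<open>p * adj p = adj p\<close> is self-adjoint, so
  \<open>adj p\<close> is.\<close>

lemma adj_unit_of_subalgebra:
  assumes "cstar_subalgebra B" "is_unit_of p B"
  shows "adj p = p"
proof -
  have "adj p \<in> B"
    using assms by (simp add: cstar_subalgebra_def is_unit_of_def)
  then have "p * adj p = adj p"
    using assms(2) by (simp add: is_unit_of_def)
  then show ?thesis
    by (metis adj_adj adj_mult)
qed

text \<open>Compression by \<open>p\<close> sharpens \<open>g \<le> 1\<close> to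
  \<open>g \<le> p\<close>. Both directions of the theorem use it to pass from an element of
  \<open>B\<close> to its complement in \<open>p\<close>.\<close>

lemma nonneg_sub_projection:
  assumes p: "adj p = p" "p * p = p" and g: "p * g = g" "g * p = g" and "nonneg (1 - g)"
  shows "nonneg (p - g)"
proof -
  have "p - g = adj p * (1 - g) * p"
    using p g by (simp add: algebra_simps)
  then show ?thesis
    using nonneg_conj[OF assms(5), of p] by simp
qed

lemma stretched_element:
  fixes g :: "'a::unital_cstar_algebra"
  assumes g: "nonneg g" "norm g \<le> 1" and \<epsilon>: "0 < \<epsilon>" "\<epsilon> \<le> 1/2" and B: "cstar_subalgebra B" "g \<in> B"
  obtains h where "h \<in> B" "nonneg h" "nonneg (1 - h)" "norm (h - g) \<le> \<epsilon>"
    "1 - h = (1 / (1 - \<epsilon>)) *\<^sub>R cut_down (1 - g) \<epsilon>"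
proof
  have a: "adj g = g"
    using g by (simp add: nonneg_def)
  have s: "0 \<le> t" "t \<le> 1" if "t \<in> rspec g" for t
    using g rspec_bound[OF that] that by (auto simp: nonneg_def)
  \<comment> \<open>\<open>max 0\<close> gives \<open>0 \<le> f \<le> 1\<close> on the whole line,
    and \<open>f 0 = 0\<close> keeps \<open>h\<close> in \<open>B\<close>.\<close>
  define f where "f t = min 1 (max 0 (t / (1 - \<epsilon>)))" for t
  have f: "continuous_on UNIV f"
    unfolding f_def using \<epsilon> by (intro continuous_intros) auto
  define h where "h = fcalc f g"
  show "h \<in> B"
    unfolding h_def by (rule fcalc_in_subalgebra[OF a f _ B]) (simp add: f_def)
  show "nonneg h"
    unfolding h_def by (rule nonneg_fcalc[OF a f]) (simp add: f_def)
  have f1: "continuous_on UNIV (\<lambda>t. 1 - f t)"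
    by (intro continuous_intros f)
  have h1: "1 - h = fcalc (\<lambda>t. 1 - f t) g"
    unfolding h_def using fcalc_diff[OF a continuous_on_const f, of 1] fcalc_const[OF a, of 1] by simp
  show "nonneg (1 - h)"
    unfolding h1 by (rule nonneg_fcalc[OF a f1]) (simp add: f_def)
  have "norm (fcalc (\<lambda>t. f t - t) g) \<le> \<epsilon>"
  proof (rule norm_fcalc_le[OF a])
    show "continuous_on UNIV (\<lambda>t. f t - t)"
      by (intro continuous_intros f)
    fix t assume "t \<in> rspec g"
    note t = s[OF this]
    show "\<bar>f t - t\<bar> \<le> \<epsilon>"
    proof (cases "t \<le> 1 - \<epsilon>")
      case True
      then have ft: "f t = t / (1 - \<epsilon>)"
        using t \<epsilon> by (simp add: f_def)
      define u where "u = t / (1 - \<epsilon>)"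
      have "f t - t = \<epsilon> * u"
        unfolding ft u_def using \<epsilon> by (simp add: field_simps)
      moreover have "0 \<le> u" "u \<le> 1"
        unfolding u_def using True t \<epsilon> by simp_all
      ultimately show ?thesis
        using \<epsilon> by (simp add: mult_left_le)
    next
      case False
      then have "f t = 1"
        using t \<epsilon> by (simp add: f_def max_def)
      with False t show ?thesis
        by simp
    qed
  qed
  then show "norm (h - g) \<le> \<epsilon>"
    unfolding h_def using fcalc_diff[OF a f continuous_on_id] fcalc_id[OF a] by (simp add: id_def)
  \<comment> \<open>Reading \<open>1 - g\<close> as a polynomial in \<open>g\<close> turns both
    sides into functions of \<open>g\<close>, to be compared pointwise on
    \<open>[0, 1]\<close>.\<close>
  have "cut_down (1 - g) \<epsilon> = fcalc (\<lambda>t. max 0 (t - \<epsilon>)) (rpoly [:1, -1:] g)"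
    using cut_down_eq_fcalc[of "1 - g" \<epsilon>] a \<epsilon> by (simp add: adj_diff)
  also have "\<dots> = fcalc (\<lambda>t. max 0 (1 - t - \<epsilon>)) g"
    by (subst fcalc_rpoly[OF a]) (auto intro!: continuous_intros)
  finally have "(1 / (1 - \<epsilon>)) *\<^sub>R cut_down (1 - g) \<epsilon> = fcalc (\<lambda>t. (1 / (1 - \<epsilon>)) * max 0 (1 - t - \<epsilon>)) g"
    using fcalc_scale[OF a, of "\<lambda>t. max 0 (1 - t - \<epsilon>)" "1 / (1 - \<epsilon>)"] by (simp add: continuous_intros)
  also have "\<dots> = fcalc (\<lambda>t. 1 - f t) g"
  proof (rule fcalc_cong[OF a _ f1])
    show "continuous_on UNIV (\<lambda>t. (1 / (1 - \<epsilon>)) * max 0 (1 - t - \<epsilon>))"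
      by (intro continuous_intros)
    fix t assume "t \<in> rspec g"
    note t = s[OF this]
    show "(1 / (1 - \<epsilon>)) * max 0 (1 - t - \<epsilon>) = 1 - f t"
    proof (cases "t \<le> 1 - \<epsilon>")
      case True
      then have "f t = t / (1 - \<epsilon>)"
        using t \<epsilon> by (simp add: f_def)
      then show ?thesis
        using True \<epsilon> by (simp add: field_simps)
    next
      case False
      then have "f t = 1"
        using t \<epsilon> by (simp add: f_def max_def)
      with False show ?thesis
        by simp
    qed
  qed
  finally show "1 - h = (1 / (1 - \<epsilon>)) *\<^sub>R cut_down (1 - g) \<epsilon>"
    by (simp add: h1)
qed

lemma norm_mult_le:
  fixes x y :: "'a::real_normed_algebra"
  assumes "norm x \<le> c" "norm y \<le> d"
  shows "norm (x * y) \<le> c * d"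
  using assms by (meson mult_mono norm_ge_zero norm_mult_ineq order_trans)

lemma gTA_imp_WTA:
  fixes \<Omega> :: "'a::unital_cstar_algebra cstar_structure set"
  assumes \<Omega>: "\<forall>C\<in>\<Omega>. unital_cstar C" and gTA: "gTA \<Omega> TYPE('a)"
  shows "WTA \<Omega> TYPE('a)"
  unfolding WTA_def
proof (intro conjI allI impI)
  show "simple_cstar TYPE('a)"
    using gTA by (simp add: gTA_def)
next
  fix \<epsilon>\<^sub>0 :: real and F :: "'a set" and a :: 'a
  assume \<epsilon>\<^sub>0: "\<epsilon>\<^sub>0 > 0" and F: "finite F" and a: "positive a \<and> a \<noteq> 0"
  define M where "M = 1 + norm a + (\<Sum>x\<in>F. norm x)"
  have M: "M \<ge> 1" "norm a \<le> M" "\<And>x. x \<in> F \<Longrightarrow> norm x \<le> M"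
    using F member_le_sum[of _ F norm] by (auto simp: M_def sum_nonneg add_increasing)
  \<comment> \<open>Replacing \<open>g\<close> by \<open>h\<close> costs at most
    \<open>\<epsilon> * M\<close> per occurrence, with at most two occurrences, and gTA\<Omega>
    contributes a further \<open>\<epsilon> \<le> \<epsilon> * M\<close>. The factor 4 leaves room
    for strictness, and \<open>1/2\<close> keeps \<open>1 - \<epsilon>\<close> positive.\<close>
  define \<epsilon> where "\<epsilon> = min (1/2) (\<epsilon>\<^sub>0 / (4 * M))"
  have \<epsilon>: "0 < \<epsilon>" "\<epsilon> \<le> 1/2"
    using \<epsilon>\<^sub>0 M by (auto simp: \<epsilon>_def)
  have "\<epsilon> \<le> \<epsilon>\<^sub>0 / (4 * M)"
    by (simp add: \<epsilon>_def)
  then have \<epsilon>M: "4 * (\<epsilon> * M) \<le> \<epsilon>\<^sub>0"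
    using M(1) by (simp add: field_simps)
  have \<epsilon>1: "\<epsilon> \<le> \<epsilon> * M"
    using M(1) \<epsilon> by simp
  have "positive (1::'a)"
    by (auto simp: positive_in_def intro: exI[of _ 1])
  then obtain B g where B: "cstar_subalgebra B" "structure_of B \<in> \<Omega>" "g \<in> B"
    and g: "positive_in B g" "norm g \<le> 1"
    and comm: "\<forall>x\<in>F. norm (x * g - g * x) < \<epsilon>"
    and appr: "\<forall>x\<in>F. approx_in (g * x) \<epsilon> B \<and> approx_in (x * g) \<epsilon> B"
    and cut: "cut_down (1 * 1 - 1 * g * 1) \<epsilon> \<precsim> a"
    and big: "norm (g * a * g) \<ge> norm a - \<epsilon>"
    using gTA[unfolded gTA_def, THEN conjunct2, rule_format, of \<epsilon> F a 1] \<epsilon>(1) F a by blast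
  obtain p where p: "is_unit_of p B"
    using \<Omega> B unital_cstar_structure_of by blast
  have pp: "adj p = p" "p * p = p"
    using adj_unit_of_subalgebra[OF B(1) p] p by (auto simp: is_unit_of_def)
  obtain h where h: "h \<in> B" "nonneg h" "nonneg (1 - h)" "norm (h - g) \<le> \<epsilon>"
    and h1: "1 - h = (1 / (1 - \<epsilon>)) *\<^sub>R cut_down (1 - g) \<epsilon>"
    by (rule stretched_element[OF positive_in_imp_nonneg[OF g(1)] g(2) \<epsilon> B(1,3)])
  have "norm h \<le> 1"
    by (rule norm_le_if_nonneg_diff) (use h in simp_all)
  have ph: "p * h = h" "h * p = h" "p \<in> B"
    using p h(1) by (auto simp: is_unit_of_def)
  have dist: "norm (h * x - g * x) \<le> \<epsilon> * M" "norm (x * h - x * g) \<le> \<epsilon> * M" if "x \<in> F" for x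
    using norm_mult_le[OF h(4) M(3)[OF that]] norm_mult_le[OF M(3)[OF that] h(4)]
    by (simp_all add: algebra_simps)
  have pph: "p - (p - h) = h"
    by simp
  show "\<exists>p g B. adj p = p \<and> p * p = p \<and> positive g \<and> positive (1 - g) \<and>
          cstar_subalgebra B \<and> is_unit_of p B \<and> structure_of B \<in> \<Omega> \<and> g \<in> B \<and>
          (\<forall>x\<in>F. approx_in ((p - g) * x) \<epsilon>\<^sub>0 B \<and> approx_in (x * (p - g)) \<epsilon>\<^sub>0 B) \<and>
          (\<forall>x\<in>F. norm ((p - g) * x - x * (p - g)) < \<epsilon>\<^sub>0) \<and>
          1 - (p - g) \<precsim> a \<and>
          norm ((p - g) * a * (p - g)) \<ge> norm a - \<epsilon>\<^sub>0"
  proof (intro exI[of _ p] exI[of _ "p - h"] exI[of _ B] conjI pp B p ballI, unfold pph)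
    show "positive (p - h)"
      unfolding positive_iff_nonneg using nonneg_sub_projection[OF pp ph(1,2) h(3)] .
    \<comment> \<open>This is \<open>1 - (p - h)\<close>, a sum of two positive elements.\<close>
    have "nonneg ((1 - p) + h)"
      using nonneg_add nonneg_one_minus_projection[OF pp] h(2) by blast
    then show "positive (1 - (p - h))"
      by (simp add: positive_iff_nonneg algebra_simps)
    have "p + (-1) *\<^sub>C h \<in> B"
      using B(1) h(1) ph(3) by (simp add: cstar_subalgebra_def)
    then show "p - h \<in> B"
      by (simp add: scaleC_minus_one)
  next
    fix x assume x: "x \<in> F"
    obtain b c where b: "b \<in> B" "norm (g * x - b) < \<epsilon>" and c: "c \<in> B" "norm (x * g - c) < \<epsilon>"
      using appr x unfolding approx_in_def by meson
    have "norm (h * x - b) \<le> norm (h * x - g * x) + norm (g * x - b)"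
      using norm_triangle_ineq[of "h * x - g * x" "g * x - b"] by simp
    then have "norm (h * x - b) < \<epsilon>\<^sub>0"
      using dist(1)[OF x] b(2) \<epsilon>M \<epsilon>1 \<epsilon> by linarith
    then show "approx_in (h * x) \<epsilon>\<^sub>0 B"
      using b(1) by (auto simp: approx_in_def)
    have "norm (x * h - c) \<le> norm (x * h - x * g) + norm (x * g - c)"
      using norm_triangle_ineq[of "x * h - x * g" "x * g - c"] by simp
    then have "norm (x * h - c) < \<epsilon>\<^sub>0"
      using dist(2)[OF x] c(2) \<epsilon>M \<epsilon>1 \<epsilon> by linarith
    then show "approx_in (x * h) \<epsilon>\<^sub>0 B"
      using c(1) by (auto simp: approx_in_def)
    show "norm (h * x - x * h) < \<epsilon>\<^sub>0"
    proof -
      have "norm (h * x - x * h) \<le> norm (h * x - g * x) + norm (x * h - x * g) + norm (x * g - g * x)"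
        using norm_triangle_ineq4[of "h * x - g * x" "x * h - x * g"]
          norm_triangle_ineq4[of "(h * x - g * x) - (x * h - x * g)" "x * g - g * x"]
        by (simp add: algebra_simps)
      moreover have "norm (x * g - g * x) < \<epsilon>"
        using comm x by blast
      ultimately show ?thesis
        using dist[OF x] \<epsilon>M \<epsilon>1 \<epsilon> by linarith
    qed
  next
    have "(1 / (1 - \<epsilon>)) *\<^sub>R cut_down (1 - g) \<epsilon> \<precsim> a"
      using cut \<epsilon> by (intro cuntz_le_scaleR) auto
    then show "1 - h \<precsim> a"
      by (simp flip: h1)
  next
    have "norm ((h - g) * a * h) \<le> \<epsilon> * M * 1" "norm (g * a * (h - g)) \<le> 1 * M * \<epsilon>"
      by (intro norm_mult_le h g M \<open>norm h \<le> 1\<close>)+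
    \<comment> \<open>Telescoping, so that each error term contains \<open>h - g\<close> once and
      otherwise only \<open>a\<close> and a factor of norm at most 1.\<close>
    moreover have "g * a * g = h * a * h - (h - g) * a * h - g * a * (h - g)"
      by (simp add: algebra_simps)
    ultimately have "norm (g * a * g) \<le> norm (h * a * h) + \<epsilon> * M + \<epsilon> * M"
      using norm_triangle_ineq4[of "h * a * h" "(h - g) * a * h"]
        norm_triangle_ineq4[of "h * a * h - (h - g) * a * h" "g * a * (h - g)"]
      by (simp add: mult.commute)
    then show "norm a - \<epsilon>\<^sub>0 \<le> norm (h * a * h)"
      using big \<epsilon>M \<epsilon>1 \<epsilon> by linarith
  qed
qed

text \<open>All estimates transfer to \<open>h = p - g\<close> with the same \<epsilon>. The element
  \<open>y\<close> enters only through the cut-down, where it is the conjugating element because it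
  is self-adjoint.\<close>

lemma WTA_imp_gTA:
  fixes \<Omega> :: "'a::unital_cstar_algebra cstar_structure set"
  assumes WTA: "WTA \<Omega> TYPE('a)"
  shows "gTA \<Omega> TYPE('a)"
  unfolding gTA_def
proof (intro conjI allI impI)
  show "simple_cstar TYPE('a)"
    using WTA by (simp add: WTA_def)
next
  fix \<epsilon> :: real and F :: "'a set" and a y :: 'a
  assume \<epsilon>: "\<epsilon> > 0" and F: "finite F" and a: "positive a \<and> positive y \<and> a \<noteq> 0"
  obtain p g B where pp: "adj p = p" "p * p = p" and g: "positive g" "positive (1 - g)" "g \<in> B"
    and B: "cstar_subalgebra B" "is_unit_of p B" "structure_of B \<in> \<Omega>"
    and appr: "\<forall>x\<in>F. approx_in ((p - g) * x) \<epsilon> B \<and> approx_in (x * (p - g)) \<epsilon> B"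
    and comm: "\<forall>x\<in>F. norm ((p - g) * x - x * (p - g)) < \<epsilon>"
    and cut: "1 - (p - g) \<precsim> a"
    and big: "norm ((p - g) * a * (p - g)) \<ge> norm a - \<epsilon>"
    using WTA[unfolded WTA_def, THEN conjunct2, rule_format, of \<epsilon> F a] \<epsilon> F a by blast
  have pg: "p * g = g" "g * p = g" "p \<in> B"
    using B(2) g(3) by (auto simp: is_unit_of_def)
  define h where "h = p - g"
  have "p + (-1) *\<^sub>C g \<in> B"
    using B(1) g(3) pg(3) by (simp add: cstar_subalgebra_def)
  then have hB: "h \<in> B"
    by (simp add: h_def scaleC_minus_one)
  have h: "nonneg h"
    unfolding h_def by (rule nonneg_sub_projection[OF pp pg(1,2)]) (use g in \<open>simp add: positive_iff_nonneg\<close>)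
  have "nonneg ((1 - p) + g)"
    using nonneg_add nonneg_one_minus_projection[OF pp] g(1) by (simp add: positive_iff_nonneg)
  then have h1: "nonneg (1 - h)"
    by (simp add: h_def algebra_simps)
  have y: "adj y = y"
    using a by (simp add: positive_iff_nonneg nonneg_def)
  have x: "y * y - y * h * y = y * (1 - h) * adj y"
    by (simp add: y algebra_simps)
  have "adj (y * (1 - h) * adj y) = y * (1 - h) * adj y"
    using h by (simp add: nonneg_def adj_mult adj_adj adj_diff mult.assoc)
  moreover have "y * (1 - h) * adj y \<precsim> a"
    using cut by (intro cuntz_le_conj) (simp add: h_def)
  ultimately have cut': "cut_down (y * y - y * h * y) \<epsilon> \<precsim> a"
    unfolding x by (intro cut_down_cuntz_le \<epsilon>)
  have "norm h \<le> 1"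
    by (rule norm_le_if_nonneg_diff) (use h h1 in simp_all)
  show "\<exists>B g. cstar_subalgebra B \<and> structure_of B \<in> \<Omega> \<and> g \<in> B \<and> positive_in B g \<and> norm g \<le> 1 \<and>
          (\<forall>x\<in>F. norm (x * g - g * x) < \<epsilon>) \<and>
          (\<forall>x\<in>F. approx_in (g * x) \<epsilon> B \<and> approx_in (x * g) \<epsilon> B) \<and>
          cut_down (y * y - y * g * y) \<epsilon> \<precsim> a \<and>
          norm (g * a * g) \<ge> norm a - \<epsilon>"
    by (intro exI[of _ B] exI[of _ h] conjI B hB nonneg_imp_positive_in h cut' \<open>norm h \<le> 1\<close>)
       (use comm appr big in \<open>auto simp: h_def norm_minus_commute\<close>)
qed

theorem theorem2p14:
  fixes \<Omega> :: "'a::unital_cstar_algebra cstar_structure set"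
  assumes "\<forall>C\<in>\<Omega>. unital_cstar C"
    and "simple_cstar TYPE('a)"
  shows "gTA \<Omega> TYPE('a) \<longleftrightarrow> WTA \<Omega> TYPE('a)"
  using gTA_imp_WTA[OF assms(1)] WTA_imp_gTA by blast

end
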